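(* Let $Y$ be a hypersurface in $\mathbb P^3$ of degree $d\ge5$. Let $P=(\ell,p_1+p_2,q_1+\cdots+q_{d-4})$ be a point of $S(Y)$ such that $\ell\not\subset Y$ and $\{p_1,p_2\}\cap\{q_1,\dots,q_{d-4}\}=\emptyset$. Then $\phi_Y:S(Y)\to B(Y)$ is immersed at $P$. If moreover $Y$ is smooth at $p_1$ and $p_2$, then $S(Y)$ is a smooth surface at $P$.
   Context: All varieties are over $\mathbb C$. For a vector space $V$, $\mathbb P(V)$ is the space of 1-dimensional subspaces of $V$. Let $G={\rm Gr}(2,4)$ be the Grassmannian of lines in $\mathbb P^3$, $\mathcal I$ its tautological rank 2 bundle, $\mathcal I^\vee$ its dual, and $\mathcal F=\mathbb P({\rm Sym}^2\mathcal I^\vee)\times_G\mathbb P({\rm Sym}^{d-4}\mathcal I^\vee)$. Points of $\mathcal F$ are the triples $P=(\ell,p_1+p_2,q_1+\cdots+q_{d-4})$ with $\ell\in G$ and $p_1+p_2$, $q_1+\cdots+q_{d-4}$ effective divisors on $\ell$ of degrees $2$ and $d-4$. For a hypersurface $Y\subset\mathbb P^3$ of degree $d\ge5$ (the zero scheme of a nonzero form $f$), the Fano congruence of bitangents to $Y$ is the closed subscheme $S(Y)\subset\mathcal F$ of those $P$ such that $Y\cap\ell$ contains $2p_1+2p_2+q_1+\cdots+q_{d-4}$ as a subscheme. Its scheme structure is that of the locus where $f|_\ell$ lies in the line spanned by $g^2h$, with $g,h$ forms on $\ell$ defining $p_1+p_2$ and $q_1+\cdots+q_{d-4}$; i.e.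 the zero scheme of the section induced by $f$ of the cokernel bundle of the natural inclusion, fiberwise $g\otimes g\otimes h\mapsto g^2h$, of the line bundle with fiber $\langle g\rangle^{\otimes2}\otimes\langle h\rangle$ into the pullback of ${\rm Sym}^d\mathcal I^\vee$ to $\mathcal F$. $B(Y)\subset G$ is the set of lines $\ell$ such that $\ell\cap Y$ contains $2p_1+2p_2+q_1+\cdots+q_{d-4}$ as a subscheme for some $p_i,q_j\in\ell$, i.e. the image of $S(Y)$ in $G$. The morphism $\phi_Y:S(Y)\to B(Y)\subset G$ is $P\mapsto\ell$. It is immersed at $P$ if the induced map of Zariski tangent spaces $T_PS(Y)\to T_\ell G$ is injective. *)

theory Defs
  imports "HOL-Analysis.Analysis" "HOL-Library.Poly_Mapping" "HOL-Library.Multiset"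
    "HOL-Computational_Algebra.Polynomial"
begin

section \<open>Multivariate polynomials\<close>

text \<open>Polynomials with variables indexed by \<open>'v\<close> are the monoid algebra over the exponent
  vectors \<open>'v \<Rightarrow>\<^sub>0 nat\<close>.\<close>

type_synonym 'v cpoly = "('v \<Rightarrow>\<^sub>0 nat) \<Rightarrow>\<^sub>0 complex"

definition cnst :: "complex \<Rightarrow> 'v cpoly" where
  "cnst c = Poly_Mapping.single 0 c"

definition var :: "'v \<Rightarrow> 'v cpoly" where
  "var i = Poly_Mapping.single (Poly_Mapping.single i 1) 1"

text \<open>The value of \<open>p\<close> at \<open>x\<close> in a commutative algebra with structure map \<open>h\<close>.\<close>

definition subst :: "(complex \<Rightarrow> 'r::comm_ring_1) \<Rightarrow> ('v \<Rightarrow> 'r) \<Rightarrow> 'v cpoly \<Rightarrow> 'r" where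
  "subst h x p = (\<Sum>m\<in>Poly_Mapping.keys p. h (Poly_Mapping.lookup p m) *
      (\<Prod>i\<in>Poly_Mapping.keys m. x i ^ Poly_Mapping.lookup m i))"

abbreviation val :: "('v \<Rightarrow> complex) \<Rightarrow> 'v cpoly \<Rightarrow> complex" where
  "val x p \<equiv> subst (\<lambda>c. c) x p"

text \<open>The differential of \<open>p\<close> at \<open>x\<close> applied to \<open>v\<close>: the coefficient of \<open>\<epsilon>\<close> in
  \<open>p(x + \<epsilon> v)\<close>, i.e. the sum of the \<open>v i * (\<partial>p/\<partial>X i)(x)\<close>.\<close>

definition differential :: "'v cpoly \<Rightarrow> ('v \<Rightarrow> complex) \<Rightarrow> ('v \<Rightarrow> complex) \<Rightarrow> complex" where
  "differential p x v = coeff (subst (\<lambda>c. [:c:]) (\<lambda>i. [:x i, v i:]) p) 1"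

section \<open>Closed subschemes of affine space\<close>

text \<open>Affine \<open>n\<close>-space has coordinate ring \<open>cpoly_ring n\<close> and points \<open>cspace n\<close>. A closed
  subscheme is given by an ideal \<open>I\<close> of \<open>cpoly_ring n\<close>.\<close>

definition cpoly_ring :: "nat \<Rightarrow> nat cpoly set" where
  "cpoly_ring n = {p. \<forall>m\<in>Poly_Mapping.keys p. Poly_Mapping.keys m \<subseteq> {..<n}}"

definition cspace :: "nat \<Rightarrow> (nat \<Rightarrow> complex) set" where
  "cspace n = {x. \<forall>i\<ge>n. x i = 0}"

definition zariski_tangent :: "nat \<Rightarrow> nat cpoly set \<Rightarrow> (nat \<Rightarrow> complex) \<Rightarrow> (nat \<Rightarrow> complex) set" where
  "zariski_tangent n I y = {v \<in> cspace n. \<forall>p\<in>I. differential p y v = 0}"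

text \<open>Smoothness over the complex numbers of relative dimension \<open>k\<close> at \<open>y\<close>, as defined in
  Bosch, Luetkebohmert, Raynaud, Neron Models, Section 2.2, Definition 3: near \<open>y\<close> the ideal
  is generated by \<open>n - k\<close> functions whose differentials at \<open>y\<close> are linearly independent. The
  neighbourhood is the principal open set \<open>q \<noteq> 0\<close>; clearing denominators, one may take the local
  generators \<open>g i\<close> in \<open>I\<close> itself and \<open>q\<close> such that \<open>q I\<close> lies in the ideal they generate.\<close>

definition smooth_at :: "nat \<Rightarrow> nat cpoly set \<Rightarrow> nat \<Rightarrow> (nat \<Rightarrow> complex) \<Rightarrow> bool" where
  "smooth_at n I k y \<longleftrightarrow>
     y \<in> cspace n \<and> (\<forall>p\<in>I. val y p = 0) \<and>
     (\<exists>r q g. r + k = n \<and> q \<in> cpoly_ring n \<and> val y q \<noteq> 0 \<and>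
        (\<forall>i<r. g i \<in> I) \<and>
        (\<forall>p\<in>I. \<exists>a. (\<forall>i<r. a i \<in> cpoly_ring n) \<and> q * p = (\<Sum>i<r. a i * g i)) \<and>
        (\<forall>c :: nat \<Rightarrow> complex.
           (\<forall>v\<in>cspace n. (\<Sum>i<r. c i * differential (g i) y v) = 0) \<longrightarrow> (\<forall>i<r. c i = 0)))"

section \<open>Hypersurfaces in projective 3-space\<close>

text \<open>Points and lines of projective 3-space are the complex subspaces of \<open>complex^4\<close> of
  dimension 1 and 2. (The prefix \<open>vec\<close> refers to complex scalars, as opposed to the real \<open>span\<close>
  and \<open>dim\<close>.)\<close>

type_synonym csub = "(complex^4) set"

definition pnt :: "csub \<Rightarrow> bool" where
  "pnt p \<longleftrightarrow> vec.subspace p \<and> vec.dim p = 1"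

definition line :: "csub \<Rightarrow> bool" where
  "line l \<longleftrightarrow> vec.subspace l \<and> vec.dim l = 2"

definition form :: "nat \<Rightarrow> 4 cpoly \<Rightarrow> bool" where
  "form d f \<longleftrightarrow> (\<forall>m\<in>Poly_Mapping.keys f. (\<Sum>i\<in>UNIV. Poly_Mapping.lookup m i) = d)"

abbreviation fval :: "4 cpoly \<Rightarrow> complex^4 \<Rightarrow> complex" where
  "fval f v \<equiv> val (($) v) f"

definition in_hypersurface :: "csub \<Rightarrow> 4 cpoly \<Rightarrow> bool" where
  "in_hypersurface L f \<longleftrightarrow> (\<forall>v\<in>L. fval f v = 0)"

definition hypersurface_smooth_at :: "4 cpoly \<Rightarrow> csub \<Rightarrow> bool" where
  "hypersurface_smooth_at f p \<longleftrightarrow> in_hypersurface p f \<and>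
     (\<forall>v\<in>p. v \<noteq> 0 \<longrightarrow> (\<exists>w. differential f (($) v) w \<noteq> 0))"

section \<open>The congruence of bitangents as a set\<close>

text \<open>An effective divisor on a line is a multiset of its points. \<open>cuts_out l D g\<close> says that \<open>g\<close>
  restricts to a form on \<open>l\<close> defining \<open>D\<close>; \<open>lam p\<close> is a linear form whose zero on \<open>l\<close> is \<open>p\<close>.
  Only the values of \<open>g\<close> on \<open>l\<close> matter.\<close>

definition eff_divisors :: "csub \<Rightarrow> nat \<Rightarrow> csub multiset set" where
  "eff_divisors l m = {D. size D = m \<and> (\<forall>p\<in>#D. pnt p \<and> p \<subseteq> l)}"

definition cuts_out :: "csub \<Rightarrow> csub multiset \<Rightarrow> (complex^4 \<Rightarrow> complex) \<Rightarrow> bool" where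
  "cuts_out l D g \<longleftrightarrow> (\<exists>c lam. c \<noteq> 0 \<and>
     (\<forall>p\<in>#D. Vector_Spaces.linear (*s) (*) (lam p) \<and> {v\<in>l. lam p v = 0} = p) \<and>
     (\<forall>v\<in>l. g v = c * (\<Prod>p\<in>#D. lam p v)))"

type_synonym flag = "csub \<times> csub multiset \<times> csub multiset"

definition flags :: "nat \<Rightarrow> flag set" where
  "flags d = {(l, D, E). line l \<and> D \<in> eff_divisors l 2 \<and> E \<in> eff_divisors l (d - 4)}"

definition bitangents :: "nat \<Rightarrow> 4 cpoly \<Rightarrow> flag set" where
  "bitangents d f = {(l, D, E) \<in> flags d.
     \<exists>g h c. cuts_out l D g \<and> cuts_out l E h \<and> (\<forall>v\<in>l. fval f v = c * ((g v)\<^sup>2 * h v))}"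

section \<open>Affine charts\<close>

text \<open>Every invertible matrix \<open>A\<close>, with columns \<open>e0, e1, e2, e3\<close>, gives an open immersion of
  affine \<open>(d+2)\<close>-space into \<open>flags d\<close>, with coordinates \<open>X 0, X 1, ...\<close>: the line is spanned by
  \<open>u = e0 + X 0 e2 + X 1 e3\<close> and \<open>w = e1 + X 2 e2 + X 3 e3\<close>, and the two divisors are defined by
  the binary forms in \<open>s, t\<close> (the coordinates of \<open>s u + t w\<close>) of degrees \<open>2\<close> and \<open>d - 4\<close> that are
  monic in \<open>s\<close> and have the other coordinates as their remaining coefficients. As \<open>A\<close> varies these
  charts cover \<open>flags d\<close>. Binary forms of degree \<open>m\<close> are represented by their dehomogenization
  at \<open>t = 1\<close>, so the coefficient of \<open>s^i t^(m-i)\<close> is the \<open>i\<close>th coefficient of a polynomial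
  in \<open>s\<close>.\<close>

definition chart_u :: "complex^4^4 \<Rightarrow> 4 \<Rightarrow> nat cpoly" where
  "chart_u A k = cnst (A $ k $ 0) + var 0 * cnst (A $ k $ 2) + var 1 * cnst (A $ k $ 3)"

definition chart_w :: "complex^4^4 \<Rightarrow> 4 \<Rightarrow> nat cpoly" where
  "chart_w A k = cnst (A $ k $ 1) + var 2 * cnst (A $ k $ 2) + var 3 * cnst (A $ k $ 3)"

definition chart_g :: "nat cpoly poly" where
  "chart_g = [:var 5, var 4, 1:]"

definition chart_h :: "nat \<Rightarrow> nat cpoly poly" where
  "chart_h d = monom 1 (d - 4) + (\<Sum>j<d - 4. monom (var (6 + j)) j)"

definition binary_form :: "nat \<Rightarrow> complex poly \<Rightarrow> complex \<Rightarrow> complex \<Rightarrow> complex" where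
  "binary_form m p s t = (\<Sum>i\<le>m. coeff p i * s ^ i * t ^ (m - i))"

definition chart_at :: "nat \<Rightarrow> complex^4^4 \<Rightarrow> (nat \<Rightarrow> complex) \<Rightarrow> flag \<Rightarrow> bool" where
  "chart_at d A y P \<longleftrightarrow> invertible A \<and> y \<in> cspace (d + 2) \<and> P \<in> flags d \<and>
     (case P of (l, D, E) \<Rightarrow>
       let u = (\<chi> k. val y (chart_u A k)); w = (\<chi> k. val y (chart_w A k)) in
       l = vec.span {u, w} \<and>
       (\<exists>g. cuts_out l D g \<and>
         (\<forall>s t. g (s *s u + t *s w) = binary_form 2 (map_poly (val y) chart_g) s t)) \<and>
       (\<exists>h. cuts_out l E h \<and>
         (\<forall>s t. h (s *s u + t *s w) = binary_form (d - 4) (map_poly (val y) (chart_h d)) s t)))"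

section \<open>The scheme structure on the congruence of bitangents\<close>

text \<open>The restriction of \<open>f\<close> to the moving line, i.e. \<open>f(s u + w)\<close> as a polynomial in \<open>s\<close>.\<close>

definition chart_f :: "complex^4^4 \<Rightarrow> 4 cpoly \<Rightarrow> nat cpoly poly" where
  "chart_f A f = subst (\<lambda>c. [:cnst c:]) (\<lambda>k. [:chart_w A k, chart_u A k:]) f"

text \<open>In the chart, the cokernel bundle is the quotient \<open>Q\<close> of the free module on the monomials
  \<open>s^i t^(d-i)\<close> by \<open>g\<^sup>2 h\<close>, so a section of the dual of \<open>Q\<close> is a linear form
  \<open>\<phi>\<close> on the free module that kills \<open>g\<^sup>2 h\<close>. The ideal of the zero scheme of the section of \<open>Q\<close>
  given by \<open>f\<close> is the set of all its values \<open>\<phi>(f)\<close> under such \<open>\<phi>\<close>.\<close>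

definition chart_ideal :: "nat \<Rightarrow> 4 cpoly \<Rightarrow> complex^4^4 \<Rightarrow> nat cpoly set" where
  "chart_ideal d f A = {\<Sum>i\<le>d. \<phi> i * coeff (chart_f A f) i | \<phi>.
     (\<forall>i\<le>d. \<phi> i \<in> cpoly_ring (d + 2)) \<and>
     (\<Sum>i\<le>d. \<phi> i * coeff (chart_g\<^sup>2 * chart_h d) i) = 0}"

text \<open>In the charts given by \<open>A\<close>, the projection to the Grassmannian is \<open>(X 0, X 1, X 2, X 3)\<close>.
  The two notions below do not depend on the chart around \<open>P\<close>.\<close>

definition immersed_at :: "nat \<Rightarrow> 4 cpoly \<Rightarrow> flag \<Rightarrow> bool" where
  "immersed_at d f P \<longleftrightarrow> (\<exists>A y. chart_at d A y P \<and>
     inj_on (\<lambda>v. \<lambda>j\<in>{..<4}. differential (var j) y v)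
       (zariski_tangent (d + 2) (chart_ideal d f A) y))"

definition smooth_surface_at :: "nat \<Rightarrow> 4 cpoly \<Rightarrow> flag \<Rightarrow> bool" where
  "smooth_surface_at d f P \<longleftrightarrow>
     (\<exists>A y. chart_at d A y P \<and> smooth_at (d + 2) (chart_ideal d f A) 2 y)"

end

theory Submission
  imports Defs "HOL-Computational_Algebra.Field_as_Ring"
    "HOL-Computational_Algebra.Polynomial_Factorial"
    "HOL-Computational_Algebra.Fundamental_Theorem_Algebra"
begin

text \<open>Choose a chart in which the given line is spanned by the first two basis vectors and contains
  no \<open>p\<^sub>i\<close> or \<open>q\<^sub>j\<close> at infinity (\<open>bitangent_chart_exists\<close>). In the affine coordinate \<open>s\<close> of the line, \<open>f\<close>
  restricts to \<open>C G\<^sup>2 H\<close>, where \<open>G\<close> and \<open>H\<close> are monic polynomials of degrees \<open>2\<close> and \<open>d - 4\<close> defining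
  the two divisors. They are coprime, since no \<open>q\<^sub>j\<close> equals a \<open>p\<^sub>i\<close>, and \<open>C \<noteq> 0\<close>, since the line
  does not lie in the surface.

  Since \<open>g\<^sup>2 h\<close> is monic of degree \<open>d\<close>, the ideal of the congruence in the chart is generated by the
  \<open>d\<close> lower coefficients of \<open>f - \<phi> g\<^sup>2 h\<close>, where \<open>\<phi>\<close> is the coefficient of \<open>s\<^sup>d\<close> in
  \<open>f\<close>. On a tangent vector that moves the line by \<open>\<xi>\<close>, \<open>g\<close> by \<open>\<gamma>\<close> and \<open>h\<close> by \<open>\<eta>\<close>, where \<open>deg \<gamma> < 2\<close> and \<open>deg \<eta> < d - 4\<close>, the
  differentials of these generators are the coefficients of
  \<open>\<partial>\<^sub>\<xi> f - \<kappa> G\<^sup>2 H - C G (2 \<gamma> H + \<eta> G)\<close>, where \<open>\<kappa>\<close> makes the degree less than \<open>d\<close>.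

  Immersion: if \<open>\<xi> = 0\<close> and this polynomial vanishes, then \<open>2 \<gamma> H + \<eta> G = 0\<close>, and coprimality and
  the degrees give \<open>\<gamma> = \<eta> = 0\<close> (\<open>tangent_determined_by_line\<close>).

  Smoothness: the differentials are independent if every polynomial of degree less than \<open>d\<close> occurs.
  By coprimality the terms \<open>G (2 \<gamma> H + \<eta> G)\<close> give all multiples of \<open>G\<close> of degree less than \<open>d\<close>, so it
  suffices that the \<open>\<partial>\<^sub>\<xi> f\<close> give all residues modulo \<open>G\<close>. Here \<open>\<partial>\<^sub>\<xi> f = \<xi>\<^sub>2 \<partial>\<^sub>2 f + \<xi>\<^sub>3 \<partial>\<^sub>3 f\<close> with
  arbitrary linear polynomials \<open>\<xi>\<^sub>2\<close> and \<open>\<xi>\<^sub>3\<close>. At a zero of \<open>G\<close> the derivatives of \<open>f\<close> along the line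
  vanish, so smoothness of the surface forces one of the transverse derivatives \<open>\<partial>\<^sub>2 f\<close> and \<open>\<partial>\<^sub>3 f\<close> to
  be nonzero; a Bezout identity for \<open>\<partial>\<^sub>2 f\<close>, \<open>\<partial>\<^sub>3 f\<close> and \<open>G\<close> then gives all residues
  (\<open>differential_surjective\<close>).\<close>

section \<open>Substitution into polynomials\<close>

text \<open>Evaluating a polynomial at a point of a commutative algebra, taking coefficientwise values and
  evaluating at a dual number are all ring homomorphisms, and every ring homomorphism commutes
  with substitution. These two facts replace most computations with individual monomials.\<close>

definition ring_morphism :: "('a::comm_ring_1 \<Rightarrow> 'b::comm_ring_1) \<Rightarrow> bool" where
  "ring_morphism \<phi> \<longleftrightarrow> \<phi> 1 = 1 \<and> (\<forall>a b. \<phi> (a + b) = \<phi> a + \<phi> b) \<and> (\<forall>a b. \<phi> (a * b) = \<phi> a * \<phi> b)"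

lemma ring_morphismI:
  assumes "\<phi> 1 = 1" "\<And>a b. \<phi> (a + b) = \<phi> a + \<phi> b" "\<And>a b. \<phi> (a * b) = \<phi> a * \<phi> b"
  shows "ring_morphism \<phi>"
  using assms by (simp add: ring_morphism_def)

lemma ring_morphism_simps:
  assumes "ring_morphism \<phi>"
  shows "\<phi> 0 = 0" "\<phi> 1 = 1" "\<phi> (a + b) = \<phi> a + \<phi> b" "\<phi> (a * b) = \<phi> a * \<phi> b"
    "\<phi> (a ^ n) = \<phi> a ^ n" "\<phi> (sum g S) = (\<Sum>i\<in>S. \<phi> (g i))" "\<phi> (prod g S) = (\<Prod>i\<in>S. \<phi> (g i))"
    "\<phi> (- a) = - \<phi> a" "\<phi> (a - b) = \<phi> a - \<phi> b"
proof -
  have add: "\<phi> (a + b) = \<phi> a + \<phi> b" and mult: "\<phi> (a * b) = \<phi> a * \<phi> b" and one: "\<phi> 1 = 1" for a b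
    using assms by (auto simp: ring_morphism_def)
  have zero: "\<phi> 0 = 0" using add[of 0 0] by simp
  have minus: "\<phi> (- a) = - \<phi> a" for a
    using add[of a "- a"] zero by (simp add: eq_neg_iff_add_eq_0 add.commute)
  show "\<phi> 0 = 0" "\<phi> 1 = 1" "\<phi> (a + b) = \<phi> a + \<phi> b" "\<phi> (a * b) = \<phi> a * \<phi> b" "\<phi> (- a) = - \<phi> a"
    using zero one add mult minus by auto
  show "\<phi> (a - b) = \<phi> a - \<phi> b" using add[of a "- b"] minus by simp
  show "\<phi> (a ^ n) = \<phi> a ^ n" by (induction n) (auto simp: one mult)
  show "\<phi> (sum g S) = (\<Sum>i\<in>S. \<phi> (g i))"
    by (induction S rule: infinite_finite_induct) (auto simp: zero add)
  show "\<phi> (prod g S) = (\<Prod>i\<in>S. \<phi> (g i))"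
    by (induction S rule: infinite_finite_induct) (auto simp: one mult)
qed

lemma ring_morphism_id: "ring_morphism (\<lambda>c. c)"
  by (simp add: ring_morphism_def)

lemma ring_morphism_const_poly: "ring_morphism (\<lambda>c. [:c:])"
  by (rule ring_morphismI) (auto simp: one_pCons)

lemma ring_morphism_poly: "ring_morphism (\<lambda>p. poly p s)"
  by (rule ring_morphismI) auto

lemma ring_morphism_map_poly:
  assumes "ring_morphism \<phi>"
  shows "ring_morphism (map_poly \<phi>)"
proof (rule ring_morphismI)
  note m = ring_morphism_simps[OF assms]
  show "map_poly \<phi> 1 = 1" by (simp add: m)
  show "map_poly \<phi> (p + q) = map_poly \<phi> p + map_poly \<phi> q" for p q
    by (rule poly_eqI) (simp add: coeff_map_poly m)
  show "map_poly \<phi> (p * q) = map_poly \<phi> p * map_poly \<phi> q" for p q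
    by (rule poly_eqI) (simp add: coeff_map_poly m coeff_mult)
qed

lemma ring_morphism_compose:
  assumes "ring_morphism \<phi>" "ring_morphism \<psi>"
  shows "ring_morphism (\<lambda>a. \<psi> (\<phi> a))"
  using assms by (simp add: ring_morphism_def)

lemma ring_morphism_subst:
  assumes "ring_morphism \<phi>"
  shows "\<phi> (subst h x p) = subst (\<lambda>c. \<phi> (h c)) (\<lambda>i. \<phi> (x i)) p"
  by (simp add: subst_def ring_morphism_simps[OF assms])

definition monomial_at :: "('v \<Rightarrow> 'r::comm_ring_1) \<Rightarrow> ('v \<Rightarrow>\<^sub>0 nat) \<Rightarrow> 'r" where
  "monomial_at x m = (\<Prod>i\<in>Poly_Mapping.keys m. x i ^ Poly_Mapping.lookup m i)"

lemma monomial_at_superset: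
  assumes "finite S" "Poly_Mapping.keys m \<subseteq> S"
  shows "monomial_at x m = (\<Prod>i\<in>S. x i ^ Poly_Mapping.lookup m i)"
  unfolding monomial_at_def using assms
  by (intro prod.mono_neutral_left) (auto simp: in_keys_iff)

lemma monomial_at_add: "monomial_at x (m + n) = monomial_at x m * monomial_at x n"
proof -
  let ?S = "Poly_Mapping.keys m \<union> Poly_Mapping.keys n"
  have "monomial_at x k = (\<Prod>i\<in>?S. x i ^ Poly_Mapping.lookup k i)" if "k \<in> {m, n, m + n}" for k
    using that keys_add[of m n] by (intro monomial_at_superset) auto
  then show ?thesis
    by (simp add: lookup_add power_add prod.distrib)
qed

lemma subst_superset:
  assumes "ring_morphism h" "finite S" "Poly_Mapping.keys p \<subseteq> S"
  shows "subst h x p = (\<Sum>m\<in>S. h (Poly_Mapping.lookup p m) * monomial_at x m)"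
  unfolding subst_def monomial_at_def using assms
  by (intro sum.mono_neutral_left) (auto simp: in_keys_iff ring_morphism_simps(1)[OF assms(1)])

lemma subst_add:
  assumes "ring_morphism h"
  shows "subst h x (p + q) = subst h x p + subst h x q"
proof -
  let ?S = "Poly_Mapping.keys p \<union> Poly_Mapping.keys q"
  have "subst h x r = (\<Sum>m\<in>?S. h (Poly_Mapping.lookup r m) * monomial_at x m)" if "r \<in> {p, q, p + q}" for r
    using that keys_add[of p q] by (intro subst_superset assms) auto
  then show ?thesis
    by (simp add: lookup_add ring_morphism_simps(3)[OF assms] distrib_right sum.distrib)
qed

lemma subst_single:
  assumes "ring_morphism h"
  shows "subst h x (Poly_Mapping.single m c) = h c * monomial_at x m"
  by (subst subst_superset[OF assms, of "{m}"]) auto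

lemma subst_sum:
  assumes "ring_morphism h"
  shows "subst h x (sum g S) = (\<Sum>i\<in>S. subst h x (g i))"
proof -
  have "subst h x 0 = 0" by (simp add: subst_def)
  then show ?thesis
    by (induction S rule: infinite_finite_induct) (auto simp: subst_add[OF assms])
qed

lemma sum_of_monomials:
  "(p :: 'v cpoly) = (\<Sum>m\<in>Poly_Mapping.keys p. Poly_Mapping.single m (Poly_Mapping.lookup p m))"
proof (rule poly_mapping_eqI)
  fix k
  have "Poly_Mapping.lookup (\<Sum>m\<in>S. Poly_Mapping.single m (Poly_Mapping.lookup p m)) k =
      (if k \<in> S then Poly_Mapping.lookup p k else 0)" if "finite S" for S
    using that by induction (auto simp: lookup_add lookup_single when_def)
  from this[of "Poly_Mapping.keys p"]
  show "Poly_Mapping.lookup p k =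
    Poly_Mapping.lookup (\<Sum>m\<in>Poly_Mapping.keys p. Poly_Mapping.single m (Poly_Mapping.lookup p m)) k"
    by (simp add: in_keys_iff)
qed

text \<open>Multiplicativity is checked on monomials, since both sides are biadditive.\<close>

lemma subst_morphism:
  fixes x :: "'v \<Rightarrow> 'r::comm_ring_1"
  assumes h: "ring_morphism h"
  shows "ring_morphism (subst h x)"
proof (rule ring_morphismI)
  show "subst h x 1 = 1"
    using subst_single[OF h, of x 0 1] by (simp add: ring_morphism_simps[OF h] monomial_at_def)
  show "subst h x (p + q) = subst h x p + subst h x q" for p q
    by (rule subst_add[OF h])
  fix p q :: "'v cpoly"
  let ?c = Poly_Mapping.lookup
  let ?t = "\<lambda>p m. Poly_Mapping.single m (?c p m)"
  have "p * q = (\<Sum>m\<in>Poly_Mapping.keys p. ?t p m) * (\<Sum>n\<in>Poly_Mapping.keys q. ?t q n)"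
    by (simp flip: sum_of_monomials)
  also have "\<dots> = (\<Sum>m\<in>Poly_Mapping.keys p. \<Sum>n\<in>Poly_Mapping.keys q.
      Poly_Mapping.single (m + n) (?c p m * ?c q n))"
    by (simp add: sum_product mult_single)
  also have "subst h x \<dots> = (\<Sum>m\<in>Poly_Mapping.keys p. \<Sum>n\<in>Poly_Mapping.keys q.
      (h (?c p m) * monomial_at x m) * (h (?c q n) * monomial_at x n))"
    by (simp add: subst_sum[OF h] subst_single[OF h] monomial_at_add ring_morphism_simps(4)[OF h]
        mult_ac)
  also have "\<dots> = subst h x p * subst h x q"
    by (simp add: sum_product subst_def monomial_at_def)
  finally show "subst h x (p * q) = subst h x p * subst h x q" .
qed

lemma subst_cnst [simp]: "ring_morphism h \<Longrightarrow> subst h x (cnst c) = h c"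
  by (simp add: cnst_def subst_single monomial_at_def)

lemma subst_var [simp]: "ring_morphism h \<Longrightarrow> subst h x (var i) = x i"
  by (simp add: var_def subst_single monomial_at_def ring_morphism_simps)

lemmas val_morphism = subst_morphism[OF ring_morphism_id]
lemmas jet_morphism = subst_morphism[OF ring_morphism_const_poly]

section \<open>Differentials\<close>

text \<open>The restriction of a polynomial to the parametrized line \<open>x + \<epsilon> v\<close>. Its coefficient of
  \<open>\<epsilon>\<close> is the differential, so the Leibniz rule is the multiplicativity of this restriction.\<close>

abbreviation jet :: "('v \<Rightarrow> complex) \<Rightarrow> ('v \<Rightarrow> complex) \<Rightarrow> 'v cpoly \<Rightarrow> complex poly" where
  "jet x v \<equiv> subst (\<lambda>c. [:c:]) (\<lambda>i. [:x i, v i:])"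

lemma poly_jet: "poly (jet x v p) s = val (\<lambda>i. x i + s * v i) p"
  by (simp add: ring_morphism_subst[OF ring_morphism_poly])

lemma coeff_jet_0: "coeff (jet x v p) 0 = val x p"
  using poly_jet[of x v p 0] by (simp add: poly_0_coeff_0)

lemma coeff_mult_1: "coeff (p * q) (Suc 0) = coeff p 0 * coeff q (Suc 0) + coeff p (Suc 0) * coeff q 0"
  by (simp add: coeff_mult)

lemma differential_mult:
  "differential (p * q) x v = val x p * differential q x v + differential p x v * val x q"
  by (simp add: differential_def ring_morphism_simps[OF jet_morphism] coeff_mult_1 coeff_jet_0)

lemma differential_simps:
  "differential (p + q) x v = differential p x v + differential q x v"
  "differential (p - q) x v = differential p x v - differential q x v"
  "differential (sum g S) x v = (\<Sum>i\<in>S. differential (g i) x v)"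
  "differential 0 x v = 0" "differential 1 x v = 0"
  "differential (var i) x v = v i" "differential (cnst c) x v = 0"
  by (simp_all add: differential_def ring_morphism_simps[OF jet_morphism] coeff_sum
      ring_morphism_const_poly)

text \<open>This relation between the restrictions of one polynomial to three lines through the same point,
  in the directions \<open>a v + b w\<close>, \<open>v\<close> and \<open>w\<close>, passes from the coordinates to their powers, products
  and linear combinations. Hence it holds for every polynomial, and the differential is linear in
  the direction.\<close>

definition tangent_combination ::
    "complex \<Rightarrow> complex \<Rightarrow> complex poly \<Rightarrow> complex poly \<Rightarrow> complex poly \<Rightarrow> bool" where
  "tangent_combination a b P P1 P2 \<longleftrightarrow> coeff P1 0 = coeff P 0 \<and> coeff P2 0 = coeff P 0 \<and>
     coeff P 1 = a * coeff P1 1 + b * coeff P2 1"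

lemma tangent_combination_mult:
  "tangent_combination a b P P1 P2 \<Longrightarrow> tangent_combination a b Q Q1 Q2 \<Longrightarrow>
    tangent_combination a b (P * Q) (P1 * Q1) (P2 * Q2)"
  by (simp add: tangent_combination_def coeff_mult_1 coeff_mult_0 algebra_simps)

lemma tangent_combination_power:
  "tangent_combination a b P P1 P2 \<Longrightarrow> tangent_combination a b (P ^ n) (P1 ^ n) (P2 ^ n)"
  by (induction n) (auto intro: tangent_combination_mult simp: tangent_combination_def[of _ _ 1])

lemma tangent_combination_prod:
  "(\<And>i. i \<in> S \<Longrightarrow> tangent_combination a b (P i) (P1 i) (P2 i)) \<Longrightarrow>
    tangent_combination a b (\<Prod>i\<in>S. P i) (\<Prod>i\<in>S. P1 i) (\<Prod>i\<in>S. P2 i)"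
  by (induction S rule: infinite_finite_induct)
    (auto intro: tangent_combination_mult simp: tangent_combination_def[of _ _ 1])

lemma differential_linear:
  "differential p x (\<lambda>i. a * v i + b * w i) = a * differential p x v + b * differential p x w"
proof -
  have "tangent_combination a b (\<Prod>i\<in>S. [:x i, a * v i + b * w i:] ^ n i)
      (\<Prod>i\<in>S. [:x i, v i:] ^ n i) (\<Prod>i\<in>S. [:x i, w i:] ^ n i)" for S and n :: "'a \<Rightarrow> nat"
    by (intro tangent_combination_prod tangent_combination_power)
      (simp add: tangent_combination_def)
  then show ?thesis
    by (simp add: differential_def subst_def coeff_sum sum_distrib_left tangent_combination_def
        algebra_simps flip: sum.distrib)
qed

definition val_poly :: "('v \<Rightarrow> complex) \<Rightarrow> 'v cpoly poly \<Rightarrow> complex poly" where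
  "val_poly y = map_poly (val y)"

definition diff_poly :: "('v \<Rightarrow> complex) \<Rightarrow> ('v \<Rightarrow> complex) \<Rightarrow> 'v cpoly poly \<Rightarrow> complex poly" where
  "diff_poly y v = map_poly (\<lambda>p. differential p y v)"

lemma coeff_val_poly [simp]: "coeff (val_poly y P) i = val y (coeff P i)"
  by (simp add: val_poly_def coeff_map_poly ring_morphism_simps[OF val_morphism])

lemma coeff_diff_poly [simp]: "coeff (diff_poly y v P) i = differential (coeff P i) y v"
  by (simp add: diff_poly_def coeff_map_poly differential_simps)

lemma val_poly_morphism: "ring_morphism (val_poly y)"
  unfolding val_poly_def by (rule ring_morphism_map_poly[OF val_morphism])

lemma diff_poly_mult:
  "diff_poly y v (P * Q) = val_poly y P * diff_poly y v Q + diff_poly y v P * val_poly y Q"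
  by (rule poly_eqI)
    (simp add: coeff_mult differential_simps differential_mult sum.distrib)

text \<open>Differentiating the coefficients of the restriction of \<open>f\<close> to a moving line and then evaluating
  at a point \<open>s\<close> of the line is the same as differentiating \<open>f\<close> at that point in the direction in
  which it moves: both are the coefficient of \<open>\<epsilon>\<close> in the image of \<open>f\<close> under one ring homomorphism.
  The hypotheses say that the two vectors spanning the line move affinely in \<open>\<epsilon>\<close>.\<close>

lemma poly_val_diff_poly_subst:
  fixes U W :: "'k \<Rightarrow> 'v cpoly" and f :: "'k cpoly"
  defines "F \<equiv> subst (\<lambda>c. [:cnst c:]) (\<lambda>k. [:W k, U k:]) f"
  assumes U: "\<And>k. jet y v (U k) = [:u k, u' k:]" and W: "\<And>k. jet y v (W k) = [:w k, w' k:]"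
  shows "poly (val_poly y F) s = val (\<lambda>k. w k + s * u k) f"
    and "poly (diff_poly y v F) s = differential f (\<lambda>k. w k + s * u k) (\<lambda>k. w' k + s * u' k)"
proof -
  define \<Psi> where "\<Psi> = (\<lambda>P. poly (map_poly (jet y v) P) [:s:])"
  have "ring_morphism \<Psi>"
    unfolding \<Psi>_def
    by (rule ring_morphism_compose[OF ring_morphism_map_poly[OF jet_morphism] ring_morphism_poly])
  from ring_morphism_subst[OF this, of "\<lambda>c. [:cnst c:]" "\<lambda>k. [:W k, U k:]" f]
  have \<Psi>F: "\<Psi> F = jet (\<lambda>k. w k + s * u k) (\<lambda>k. w' k + s * u' k) f"
    by (simp add: F_def \<Psi>_def map_poly_pCons ring_morphism_simps(1)[OF jet_morphism]
        ring_morphism_const_poly U W mult.commute)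
  have coeff_\<Psi>: "coeff (\<Psi> F) n = poly (map_poly (\<lambda>p. coeff (jet y v p) n) F) s" for n
  proof -
    have "coeff (\<Psi> P) n = poly (map_poly (\<lambda>p. coeff (jet y v p) n) P) s" for P
      by (induction P) (simp_all add: \<Psi>_def map_poly_pCons ring_morphism_simps(1)[OF jet_morphism])
    then show ?thesis .
  qed
  show "poly (val_poly y F) s = val (\<lambda>k. w k + s * u k) f"
    using coeff_\<Psi>[of 0] by (simp add: \<Psi>F coeff_jet_0 val_poly_def)
  show "poly (diff_poly y v F) s = differential f (\<lambda>k. w k + s * u k) (\<lambda>k. w' k + s * u' k)"
    using coeff_\<Psi>[of 1] by (simp add: \<Psi>F differential_def diff_poly_def)
qed

section \<open>Polynomials without common roots\<close>

lemma poly_eqI_values: "(\<And>s. poly p s = poly q s) \<Longrightarrow> p = q" for p q :: "complex poly"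
  by (rule iffD1[OF poly_eq_poly_eq_iff ext])

text \<open>The greatest common divisor has no root, so by the fundamental theorem of algebra it is
  constant.\<close>

lemma bezout_no_common_root:
  fixes p q r :: "complex poly"
  assumes "r \<noteq> 0" and no_root: "\<And>s. \<not> (poly p s = 0 \<and> poly q s = 0 \<and> poly r s = 0)"
  obtains a b c where "a * p + b * q + c * r = 1"
proof -
  define e where "e = gcd p (gcd q r)"
  have "e \<noteq> 0" using \<open>r \<noteq> 0\<close> by (simp add: e_def)
  have "poly e s \<noteq> 0" for s
  proof
    assume "poly e s = 0"
    then have "[:-s, 1:] dvd e" by (simp add: poly_eq_0_iff_dvd)
    then have "[:-s, 1:] dvd p" "[:-s, 1:] dvd q" "[:-s, 1:] dvd r"
      by (auto simp: e_def)
    then show False using no_root[of s] by (simp add: poly_eq_0_iff_dvd)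
  qed
  then have "degree e = 0"
    using fundamental_theorem_of_algebra constant_degree[of e] by blast
  then have "is_unit e" using \<open>e \<noteq> 0\<close> by (simp add: is_unit_iff_degree)
  then have "e = 1" by (simp add: e_def is_unit_gcd_iff)
  obtain b' c' where "b' * q + c' * r = gcd q r"
    using bezout_coefficients_fst_snd by blast
  moreover obtain a b where "a * p + b * gcd q r = e"
    unfolding e_def using bezout_coefficients_fst_snd by blast
  ultimately have "a * p + b * (b' * q + c' * r) = 1"
    using \<open>e = 1\<close> by simp
  then have "a * p + (b * b') * q + (b * c') * r = 1"
    by (simp add: algebra_simps)
  then show ?thesis by (rule that)
qed

text \<open>The coefficients of a Bezout identity may be reduced modulo \<open>g\<close>. This treats a divisor \<open>g = 0\<close>
  with a double point exactly like one with distinct points.\<close>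

lemma linear_combination_mod:
  fixes a b g T :: "complex poly"
  assumes "degree g > 0" and "\<And>s. \<not> (poly a s = 0 \<and> poly b s = 0 \<and> poly g s = 0)"
  obtains x y where "degree x < degree g" "degree y < degree g" "g dvd T - (x * a + y * b)"
proof -
  have "g \<noteq> 0" using assms(1) by auto
  obtain x y z where xyz: "x * a + y * b + z * g = 1"
    using bezout_no_common_root[OF \<open>g \<noteq> 0\<close>] assms(2) by blast
  have deg: "degree (p mod g) < degree g" for p
    using assms(1) degree_mod_less'[OF \<open>g \<noteq> 0\<close>, of p] by (cases "p mod g = 0") auto
  have T: "T = (T * x) * a + (T * y) * b + (T * z) * g"
    using arg_cong[OF xyz, of "(*) T"] by (simp add: algebra_simps)
  have mod: "p mod g = p - p div g * g" for p
    by (simp add: minus_div_mult_eq_mod)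
  have "T - ((T * x) mod g * a + (T * y) mod g * b) =
      g * ((T * x) div g * a + (T * y) div g * b + T * z)"
    unfolding mod by (subst (1) T) (simp add: algebra_simps)
  then have "g dvd T - ((T * x) mod g * a + (T * y) mod g * b)" by simp
  then show ?thesis
    by (rule that[OF deg deg])
qed

text \<open>Together with its uniqueness part below, this says that for coprime \<open>g\<close> and \<open>h\<close> the linear map
  \<open>(x, y) \<mapsto> x h + y g\<close> is bijective from the pairs with \<open>deg x < deg g\<close> and \<open>deg y < deg h\<close> onto the
  polynomials of degree less than \<open>deg g + deg h\<close>.\<close>

lemma coprime_degree_split:
  fixes g h R :: "complex poly"
  assumes "degree g > 0" and "degree h > 0" and "degree R < degree g + degree h"
    and "\<And>s. \<not> (poly g s = 0 \<and> poly h s = 0)"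
  obtains x y where "degree x < degree g" "degree y < degree h" "R = x * h + y * g"
proof -
  obtain x where x: "degree x < degree g" "g dvd R - x * h"
    using linear_combination_mod[of g h 0 R] assms(1,4) by auto
  then obtain y where y: "R - x * h = y * g" by (metis dvd_def mult.commute)
  have "degree y < degree h"
  proof (cases "y = 0")
    case False
    have "g \<noteq> 0" using assms(1) by auto
    have "degree (x * h) < degree g + degree h"
      using degree_mult_le[of x h] x(1) by linarith
    then have "degree (R - x * h) < degree g + degree h"
      using assms(3) by (metis degree_diff_less)
    then show ?thesis
      using False \<open>g \<noteq> 0\<close> by (simp add: y degree_mult_eq)
  qed (use assms(2) in simp)
  with x y that show ?thesis by (metis add.commute diff_add_cancel)
qed

lemma coprime_degree_unique:
  fixes g h x y :: "complex poly"
  assumes "degree x < degree g" and "h \<noteq> 0"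
    and "\<And>s. \<not> (poly g s = 0 \<and> poly h s = 0)" and eq: "x * h + y * g = 0"
  shows "x = 0 \<and> y = 0"
proof -
  have "g \<noteq> 0" using assms(1) by auto
  then obtain a b c where abc: "a * h + b * h + c * g = 1"
    using bezout_no_common_root[of g h h] assms(3) by blast
  have "x = (a + b) * (x * h) + x * c * g"
    using arg_cong[OF abc, of "(*) x"] by (simp add: algebra_simps)
  also have "x * h = - y * g" using eq by (simp add: eq_neg_iff_add_eq_0)
  finally have x: "x = (a + b) * (- y * g) + x * c * g" .
  have "g dvd (a + b) * (- y * g) + x * c * g" by (intro dvd_add dvd_mult dvd_refl)
  then have "g dvd x" unfolding x[symmetric] .
  then have "x = 0" using assms(1) dvd_imp_degree_le[of g x] by (metis leD)
  then show ?thesis using eq \<open>g \<noteq> 0\<close> by simp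
qed

section \<open>Points and divisors on a line\<close>

lemma pnt_eqI:
  assumes "pnt p" "pnt q" "x \<in> p" "x \<in> q" "x \<noteq> 0"
  shows "p = q"
proof -
  have "r = vec.span {x}" if "pnt r" "x \<in> r" for r
  proof -
    from that have r: "vec.subspace r" "vec.dim r = 1" by (auto simp: pnt_def)
    have "vec.independent {x}" using \<open>x \<noteq> 0\<close> by (simp add: vec.independent_insert)
    then have "r \<subseteq> vec.span {x}"
      using r that(2) by (intro vec.card_ge_dim_independent) auto
    moreover have "vec.span {x} \<subseteq> r"
      using r that(2) by (intro vec.span_minimal) auto
    ultimately show ?thesis by blast
  qed
  then show ?thesis using assms by metis
qed

text \<open>A line has infinitely many points, so its first basis vector can be chosen off any finite set
  of points. In the chart that it defines, none of these points lies at infinity.\<close>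

lemma line_basis_avoiding:
  assumes "line l" and S: "finite S" "\<And>p. p \<in> S \<Longrightarrow> pnt p"
  obtains u w where "l = vec.span {u, w}" "vec.independent {u, w}" "u \<noteq> w" "\<forall>p\<in>S. u \<notin> p"
proof -
  obtain B where B: "B \<subseteq> l" "vec.independent B" "l \<subseteq> vec.span B" "card B = 2"
    using assms(1) vec.basis_exists[of l] by (metis line_def)
  then obtain b w where bw: "B = {b, w}" "b \<noteq> w" by (meson card_2_iff)
  have "w \<noteq> 0" using B(2) bw vec.dependent_zero by blast
  have "b \<notin> vec.span {w}"
    using B(2) bw by (simp add: vec.independent_insert)
  \<comment> \<open>The candidates are the vectors \<open>b + z w\<close>. A point containing two of them would contain \<open>w\<close>
    and \<open>b\<close>, hence the whole line; so each point excludes at most one value of \<open>z\<close>.\<close>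
  have one: "z = z'" if "pnt p" "b + z *s w \<in> p" "b + z' *s w \<in> p" for p z z'
  proof (rule ccontr)
    assume "z \<noteq> z'"
    have sub: "vec.subspace p" using that(1) by (simp add: pnt_def)
    have "(z - z') *s w \<in> p"
      using vec.subspace_diff[OF sub that(2,3)] by (simp add: vec.scale_left_diff_distrib)
    then have "inverse (z - z') *s ((z - z') *s w) \<in> p"
      by (rule vec.subspace_scale[OF sub])
    moreover have "inverse (z - z') *s ((z - z') *s w) = w"
      using \<open>z \<noteq> z'\<close> by (simp only: vec.scale_scale) simp
    ultimately have "w \<in> p" by simp
    then have "b \<in> p"
      using vec.subspace_diff[OF sub that(2) vec.subspace_scale[OF sub \<open>w \<in> p\<close>, of z]] by simp
    have "pnt p \<Longrightarrow> w \<in> p \<Longrightarrow> vec.dim {b, w} \<le> 1"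
      using \<open>b \<in> p\<close> vec.dim_subset[of "{b, w}" p] by (simp add: pnt_def)
    moreover have "vec.dim {b, w} = 2"
      using B bw by (metis vec.dim_eq_card_independent)
    ultimately show False using that(1) \<open>w \<in> p\<close> by simp
  qed
  have "finite (\<Union>p\<in>S. {z. b + z *s w \<in> p})"
  proof (intro finite_UN_I S(1))
    fix p assume "p \<in> S"
    then have "\<exists>z. {z. b + z *s w \<in> p} \<subseteq> {z}" using one[OF S(2)] by blast
    then show "finite {z. b + z *s w \<in> p}" by (meson finite.simps finite_subset)
  qed
  then obtain z where z: "\<And>p. p \<in> S \<Longrightarrow> b + z *s w \<notin> p"
    using ex_new_if_finite[OF infinite_UNIV_char_0] by (metis (mono_tags, lifting) UN_I mem_Collect_eq)
  let ?u = "b + z *s w"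
  have "?u \<notin> vec.span {w}"
  proof
    assume "?u \<in> vec.span {w}"
    then have "?u - z *s w \<in> vec.span {w}"
      by (rule vec.span_diff[OF _ vec.span_scale[OF vec.span_base]]) auto
    then show False using \<open>b \<notin> vec.span {w}\<close> by simp
  qed
  moreover from this have "?u \<noteq> w" using vec.span_base[of w "{w}"] by auto
  moreover have "vec.independent {w}" using \<open>w \<noteq> 0\<close> by (simp add: vec.independent_insert)
  ultimately have ind: "vec.independent {?u, w}" "?u \<noteq> w"
    using vec.independent_insertI[of ?u "{w}"] by metis+
  have l: "vec.subspace l" "vec.dim l = 2" using assms(1) by (auto simp: line_def)
  have mem: "{?u, w} \<subseteq> l"
    using B(1) bw l(1) by (auto intro: vec.subspace_add vec.subspace_scale)
  have "l \<subseteq> vec.span {?u, w}"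
    using mem ind l(2) by (intro vec.card_ge_dim_independent) auto
  moreover have "vec.span {?u, w} \<subseteq> l"
    using mem l(1) by (rule vec.span_minimal)
  ultimately show ?thesis using that ind z by blast
qed

lemma extend_to_basis:
  fixes u w :: "complex^4"
  assumes "vec.independent {u, w}" "u \<noteq> w"
  obtains a b where "vec.span {u, w, a, b} = UNIV"
proof -
  have dimle: "vec.dim (vec.span T) \<le> card T" if "finite T" for T :: "(complex^4) set"
    using that by (simp add: vec.dim_le_card')
  have dim4: "vec.dim (UNIV :: (complex^4) set) = 4" by (simp add: vec.dim_UNIV card_cart_basis)
  have ext: "\<exists>a. a \<notin> vec.span T" if "finite T" "card T < 4" for T :: "(complex^4) set"
    using dimle[OF that(1)] dim4 that(2) by (metis UNIV_eq_I leD)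
  have c2: "card {u, w} = 2" using assms(2) by simp
  obtain a where a: "a \<notin> vec.span {u, w}" using ext[of "{u, w}"] c2 by auto
  then have c3: "card {a, u, w} = 3" using c2 vec.span_base[of a "{u, w}"] by (subst card_insert_disjoint) auto
  obtain b where b: "b \<notin> vec.span {a, u, w}" using ext[of "{a, u, w}"] c3 by auto
  then have c4: "card {b, a, u, w} = 4" using c3 vec.span_base[of b "{a, u, w}"] by (subst card_insert_disjoint) auto
  have "vec.independent {b, a, u, w}"
    using assms(1) a b by (simp add: vec.independent_insertI)
  then have "UNIV \<subseteq> vec.span {b, a, u, w}"
    using c4 dim4 by (intro vec.card_ge_dim_independent) auto
  moreover have "{b, a, u, w} = {u, w, a, b}" by auto
  ultimately have "vec.span {u, w, a, b} = UNIV" by (metis top.extremum_uniqueI)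
  then show ?thesis by (rule that)
qed

lemma binary_form_mult_linear:
  assumes "degree p \<le> m"
  shows "binary_form (Suc m) ([:r, 1:] * p) s t = (s + r * t) * binary_form m p s t"
proof -
  have "coeff p (Suc m) = 0" using assms by (simp add: coeff_eq_0)
  have "binary_form (Suc m) ([:r, 1:] * p) s t =
      (\<Sum>i\<le>Suc m. r * coeff p i * s ^ i * t ^ (Suc m - i)) +
      (\<Sum>i\<le>Suc m. (case i of 0 \<Rightarrow> 0 | Suc j \<Rightarrow> coeff p j) * s ^ i * t ^ (Suc m - i))"
    by (simp add: binary_form_def coeff_pCons algebra_simps sum.distrib del: sum.atMost_Suc split: nat.splits)
  also have "(\<Sum>i\<le>Suc m. r * coeff p i * s ^ i * t ^ (Suc m - i)) = r * t * binary_form m p s t"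
    using \<open>coeff p (Suc m) = 0\<close>
    by (simp add: binary_form_def sum_distrib_left Suc_diff_le mult_ac)
  also have "(\<Sum>i\<le>Suc m. (case i of 0 \<Rightarrow> 0 | Suc j \<Rightarrow> coeff p j) * s ^ i * t ^ (Suc m - i)) =
      s * binary_form m p s t"
    by (subst sum.atMost_Suc_shift) (simp add: binary_form_def sum_distrib_left mult_ac)
  finally show ?thesis by (simp add: algebra_simps)
qed

lemma binary_form_prod:
  "binary_form (size D) (\<Prod>p\<in>#D. [:r p, 1:]) s t = (\<Prod>p\<in>#D. s + r p * t)
    \<and> degree (\<Prod>p\<in>#D. [:r p, 1:]) = size D \<and> lead_coeff (\<Prod>p\<in>#D. [:r p, 1:]) = 1"
  for r :: "'a \<Rightarrow> complex"
proof (induction D)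
  case empty
  show ?case by (simp add: binary_form_def)
next
  case (add p D)
  let ?M = "\<Prod>p\<in>#D. [:r p, 1:]"
  have "?M \<noteq> 0" using add by (metis leading_coeff_0_iff one_neq_zero)
  then have "degree ([:r p, 1:] * ?M) = Suc (size D)"
    using add by (subst degree_mult_eq) auto
  moreover have "lead_coeff ([:r p, 1:] * ?M) = 1"
    using add by (subst lead_coeff_mult) auto
  ultimately show ?case
    using add binary_form_mult_linear[of ?M "size D" "r p" s t] by simp
qed

lemma linear_form_combination:
  fixes \<phi> :: "complex^4 \<Rightarrow> complex"
  assumes "Vector_Spaces.linear (*s) (*) \<phi>"
  shows "\<phi> (s *s u + t *s w) = s * \<phi> u + t * \<phi> w" "\<phi> (x + t *s w) = \<phi> x + t * \<phi> w"
proof -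
  interpret \<phi>: Vector_Spaces.linear "(*s)" "(*)" \<phi> by fact
  show "\<phi> (s *s u + t *s w) = s * \<phi> u + t * \<phi> w" "\<phi> (x + t *s w) = \<phi> x + t * \<phi> w"
    by (simp_all add: \<phi>.add \<phi>.scale)
qed

lemma cuts_outE:
  assumes "cuts_out l D g"
  obtains c lam where "c \<noteq> 0" "\<forall>p\<in>#D. Vector_Spaces.linear (*s) (*) (lam p)"
    "\<forall>p\<in>#D. {v\<in>l. lam p v = 0} = p" "\<forall>v\<in>l. g v = c * (\<Prod>p\<in>#D. lam p v)"
proof -
  from assms obtain c lam where 1: "c \<noteq> 0"
    and 2: "\<forall>p\<in>#D. Vector_Spaces.linear (*s) (*) (lam p) \<and> {v\<in>l. lam p v = 0} = p"
    and 3: "\<forall>v\<in>l. g v = c * (\<Prod>p\<in>#D. lam p v)"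
    unfolding cuts_out_def by (elim exE conjE)
  show ?thesis
  proof (rule that[OF 1 _ _ 3])
    show "\<forall>p\<in>#D. Vector_Spaces.linear (*s) (*) (lam p)" by (rule ballI) (rule bspec[OF 2, THEN conjunct1])
    show "\<forall>p\<in>#D. {v\<in>l. lam p v = 0} = p" by (rule ballI) (rule bspec[OF 2, THEN conjunct2])
  qed
qed

text \<open>A linear form vanishing at \<open>p\<close> restricts to \<open>s u + t w\<close> as a multiple of \<open>s + r t\<close>, with a nonzero
  factor because \<open>u \<notin> p\<close>. The product over \<open>p\<close> is therefore, up to a constant, a monic binary form.\<close>

lemma cuts_out_binary_form:
  assumes "cuts_out l D g" and "vec.subspace l" and "u \<in> l" and "w \<in> l" and "\<forall>p\<in>#D. u \<notin> p"
  obtains k M where "k \<noteq> 0" "degree M = size D" "lead_coeff M = 1"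
    "\<forall>s t. g (s *s u + t *s w) = k * binary_form (size D) M s t"
    "\<forall>s. poly M s = 0 \<longleftrightarrow> (\<exists>p\<in>#D. s *s u + w \<in> p)"
proof -
  obtain c lam where c: "c \<noteq> 0"
    and lin0: "\<forall>p\<in>#D. Vector_Spaces.linear (*s) (*) (lam p)"
    and zero0: "\<forall>p\<in>#D. {v\<in>l. lam p v = 0} = p"
    and g0: "\<forall>v\<in>l. g v = c * (\<Prod>p\<in>#D. lam p v)"
    by (rule cuts_outE[OF assms(1)])
  note lin = bspec[OF lin0] and zero = bspec[OF zero0] and g = bspec[OF g0]
  have nz: "lam p u \<noteq> 0" if "p \<in># D" for p
    using zero[OF that] assms(3,5) that by blast
  define k where "k = c * (\<Prod>p\<in>#D. lam p u)"
  define M where "M = (\<Prod>p\<in>#D. [:lam p w / lam p u, 1:])"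
  have M: "binary_form (size D) M s t = (\<Prod>p\<in>#D. s + lam p w / lam p u * t)"
    "degree M = size D" "lead_coeff M = 1" for s t
    unfolding M_def using binary_form_prod[of D "\<lambda>p. lam p w / lam p u" s t] by auto
  have mem: "s *s u + t *s w \<in> l" for s t
    using assms by (intro vec.subspace_add vec.subspace_scale)
  have factor: "s * a + t * b = a * (s + b / a * t)" if "a \<noteq> 0" for a b s t :: complex
    using that by (simp add: distrib_left mult.commute)
  show ?thesis
  proof (rule that[OF _ M(2,3)])
    show "k \<noteq> 0" using c nz by (auto simp: k_def prod_mset_zero_iff)
    show "\<forall>s t. g (s *s u + t *s w) = k * binary_form (size D) M s t"
    proof (intro allI)
      fix s t :: complex
      have "lam p (s *s u + t *s w) = lam p u * (s + lam p w / lam p u * t)" if "p \<in># D" for p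
      proof -
        have "lam p (s *s u + t *s w) = s * lam p u + t * lam p w"
          by (rule linear_form_combination(1)[OF lin[OF that]])
        also have "\<dots> = lam p u * (s + lam p w / lam p u * t)"
          by (rule factor[OF nz[OF that]])
        finally show ?thesis .
      qed
      then have "(\<Prod>p\<in>#D. lam p (s *s u + t *s w)) =
          (\<Prod>p\<in>#D. lam p u * (s + lam p w / lam p u * t))"
        by (rule arg_cong[where f = prod_mset, OF image_mset_cong])
      then show "g (s *s u + t *s w) = k * binary_form (size D) M s t"
        using g[OF mem] by (simp add: M(1) k_def prod_mset.distrib mult_ac)
    qed
    show "\<forall>s. poly M s = 0 \<longleftrightarrow> (\<exists>p\<in>#D. s *s u + w \<in> p)"
    proof
      fix s :: complex
      have eval: "poly (\<Prod>p\<in>#D'. [:r p, 1:]) s = (\<Prod>p\<in>#D'. s + r p)" for r and D' :: "csub multiset"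
        by (induction D') (auto simp: algebra_simps)
      have "poly M s = 0 \<longleftrightarrow> (\<exists>p\<in>#D. s + lam p w / lam p u = 0)"
        unfolding M_def eval by (auto simp: prod_mset_zero_iff)
      also have "\<dots> \<longleftrightarrow> (\<exists>p\<in>#D. lam p (s *s u + 1 *s w) = 0)"
      proof (intro bex_cong refl)
        fix p assume "p \<in># D"
        have "lam p (s *s u + 1 *s w) = s * lam p u + 1 * lam p w"
          by (rule linear_form_combination(1)[OF lin[OF \<open>p \<in># D\<close>]])
        then show "s + lam p w / lam p u = 0 \<longleftrightarrow> lam p (s *s u + 1 *s w) = 0"
          using factor[OF nz[OF \<open>p \<in># D\<close>], of s 1 "lam p w"] nz[OF \<open>p \<in># D\<close>] by simp
      qed
      also have "\<dots> \<longleftrightarrow> (\<exists>p\<in>#D. s *s u + 1 *s w \<in> p)"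
      proof (intro bex_cong refl)
        fix p assume "p \<in># D"
        show "lam p (s *s u + 1 *s w) = 0 \<longleftrightarrow> s *s u + 1 *s w \<in> p"
          by (subst (2) zero[OF \<open>p \<in># D\<close>, symmetric]) (use mem[of s 1] in simp)
      qed
      finally show "poly M s = 0 \<longleftrightarrow> (\<exists>p\<in>#D. s *s u + w \<in> p)" by simp
    qed
  qed
qed

lemma cuts_out_poly:
  assumes "cuts_out l D g" and "vec.subspace l" and "x \<in> l" and "v \<in> l"
  obtains q where "\<And>e. g (x + e *s v) = poly q e"
proof -
  obtain c lam where c: "c \<noteq> 0"
    and lin0: "\<forall>p\<in>#D. Vector_Spaces.linear (*s) (*) (lam p)"
    and zero0: "\<forall>p\<in>#D. {v\<in>l. lam p v = 0} = p"
    and g0: "\<forall>v\<in>l. g v = c * (\<Prod>p\<in>#D. lam p v)"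
    by (rule cuts_outE[OF assms(1)])
  note lin = bspec[OF lin0] and zero = bspec[OF zero0] and g = bspec[OF g0]
  have "x + e *s v \<in> l" for e
    using assms by (intro vec.subspace_add vec.subspace_scale)
  moreover have "poly (\<Prod>p\<in>#D'. [:lam p x, lam p v:]) e = (\<Prod>p\<in>#D'. lam p x + e * lam p v)" for e D'
    by (induction D') (auto simp: distrib_right mult.assoc)
  moreover have "(\<Prod>p\<in>#D. lam p (x + e *s v)) = (\<Prod>p\<in>#D. lam p x + e * lam p v)" for e
    by (intro arg_cong[where f = prod_mset] image_mset_cong linear_form_combination(2) lin)
  ultimately have "g (x + e *s v) = poly (smult c (\<Prod>p\<in>#D. [:lam p x, lam p v:])) e" for e
    using g by simp
  then show ?thesis by (rule that)
qed

text \<open>Along the line, \<open>f\<close> is divisible by the square of \<open>g\<close>, so it vanishes to second order at the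
  points of the divisor \<open>g = 0\<close>.\<close>

lemma differential_along_bitangent:
  assumes "cuts_out l D g" and "cuts_out l E h" and "vec.subspace l"
    and f: "\<And>v. v \<in> l \<Longrightarrow> fval f v = c * ((g v)\<^sup>2 * h v)"
    and "x \<in> l" and "v \<in> l" and "p \<in># D" and "x \<in> p"
  shows "differential f (($) x) (($) v) = 0"
proof -
  obtain q where q: "\<And>e. g (x + e *s v) = poly q e" using cuts_out_poly assms by metis
  obtain r where r: "\<And>e. h (x + e *s v) = poly r e" using cuts_out_poly assms by metis
  have "g x = 0"
  proof -
    obtain c lam where c: "c \<noteq> 0"
      and lin0: "\<forall>p\<in>#D. Vector_Spaces.linear (*s) (*) (lam p)"
      and zero0: "\<forall>p\<in>#D. {v\<in>l. lam p v = 0} = p"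
      and g0: "\<forall>v\<in>l. g v = c * (\<Prod>p\<in>#D. lam p v)"
      by (rule cuts_outE[OF assms(1)])
    note lin = bspec[OF lin0] and zero = bspec[OF zero0] and g = bspec[OF g0]
    have "lam p x = 0" using zero[OF assms(7)] assms(8) by blast
    then show ?thesis using g[OF assms(5)] assms(7) by (auto simp: prod_mset_zero_iff)
  qed
  then have q0: "coeff q 0 = 0" using q[of 0] by (simp add: poly_0_coeff_0)
  have "poly (jet (($) x) (($) v) f) e = poly (smult c (q\<^sup>2 * r)) e" for e
  proof -
    have "x + e *s v \<in> l" using assms by (intro vec.subspace_add vec.subspace_scale)
    from f[OF this] have "fval f (x + e *s v) = c * ((poly q e)\<^sup>2 * poly r e)" by (simp add: q r)
    moreover have "($) (x + e *s v) = (\<lambda>i. x $ i + e * v $ i)" by auto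
    ultimately show ?thesis by (simp add: poly_jet)
  qed
  then have "jet (($) x) (($) v) f = smult c (q\<^sup>2 * r)"
    by (rule poly_eqI_values)
  then show ?thesis
    using q0 by (simp add: differential_def power2_eq_square coeff_mult_1 coeff_mult_0)
qed

section \<open>Generators of the ideal in a chart\<close>

lemma cpoly_ring_add: "p \<in> cpoly_ring n \<Longrightarrow> q \<in> cpoly_ring n \<Longrightarrow> p + q \<in> cpoly_ring n"
  using keys_add[of p q] by (fastforce simp: cpoly_ring_def)

lemma cpoly_ring_mult:
  assumes "p \<in> cpoly_ring n" "q \<in> cpoly_ring n"
  shows "p * q \<in> cpoly_ring n"
  unfolding cpoly_ring_def
proof (intro CollectI ballI)
  fix m assume "m \<in> Poly_Mapping.keys (p * q)"
  then obtain a b where m: "m = a + b" "a \<in> Poly_Mapping.keys p" "b \<in> Poly_Mapping.keys q"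
    using keys_mult[of p q] by blast
  then have "Poly_Mapping.keys a \<subseteq> {..<n}" "Poly_Mapping.keys b \<subseteq> {..<n}"
    using assms by (auto simp: cpoly_ring_def)
  then show "Poly_Mapping.keys m \<subseteq> {..<n}"
    using keys_add[of a b] m(1) by blast
qed

lemma cpoly_ring_simps: "0 \<in> cpoly_ring n" "1 \<in> cpoly_ring n" "i < n \<Longrightarrow> var i \<in> cpoly_ring n"
  "p \<in> cpoly_ring n \<Longrightarrow> - p \<in> cpoly_ring n"
  by (auto simp: cpoly_ring_def var_def)

lemma cpoly_ring_sum: "(\<And>i. i \<in> S \<Longrightarrow> g i \<in> cpoly_ring n) \<Longrightarrow> sum g S \<in> cpoly_ring n"
  by (induction S rule: infinite_finite_induct) (auto intro: cpoly_ring_add cpoly_ring_simps)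

abbreviation chart_ggh :: "nat \<Rightarrow> nat cpoly poly" where
  "chart_ggh d \<equiv> chart_g\<^sup>2 * chart_h d"

lemma coeff_chart_h:
  "coeff (chart_h d) i = (if i < d - 4 then var (6 + i) else if i = d - 4 then 1 else 0)"
proof -
  have "(\<Sum>j<d - 4. coeff (monom (var (6 + j)) j) i) = (if i < d - 4 then var (6 + i) else (0 :: nat cpoly))"
    by (simp add: sum.delta)
  then show ?thesis by (simp add: chart_h_def coeff_sum)
qed

lemma degree_chart_g: "degree chart_g = 2"
  by (simp add: chart_g_def)

lemma degree_chart_h: "degree (chart_h d) = d - 4"
  by (rule antisym) (auto intro!: degree_le le_degree simp: coeff_chart_h)

lemma coeff_chart_ggh_top:
  assumes "d \<ge> 4"
  shows "coeff (chart_ggh d) d = 1"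
proof -
  have g2: "coeff (chart_g\<^sup>2) 4 = 1" "degree (chart_g\<^sup>2) \<le> 4"
    using coeff_mult_degree_sum[of chart_g chart_g] degree_mult_le[of chart_g chart_g]
    by (simp_all add: degree_chart_g power2_eq_square) (simp add: chart_g_def numeral_2_eq_2)
  then have "degree (chart_g\<^sup>2) = 4" by (intro antisym le_degree) auto
  then show ?thesis
    using coeff_mult_degree_sum[of "chart_g\<^sup>2" "chart_h d"] g2 assms
    by (simp add: degree_chart_h coeff_chart_h)
qed

lemma coeff_chart_ggh_mem:
  assumes "d \<ge> 4"
  shows "coeff (chart_ggh d) i \<in> cpoly_ring (d + 2)"
proof -
  have "coeff chart_g i \<in> cpoly_ring (d + 2)" for i
    using assms by (auto simp: chart_g_def coeff_pCons cpoly_ring_simps split: nat.split)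
  moreover have "coeff (chart_h d) i \<in> cpoly_ring (d + 2)" for i
    by (auto simp: coeff_chart_h cpoly_ring_simps)
  ultimately show ?thesis
    by (auto simp: coeff_mult power2_eq_square intro!: cpoly_ring_sum cpoly_ring_mult)
qed

text \<open>Because \<open>g\<^sup>2 h\<close> is monic of degree \<open>d\<close>, with coefficients \<open>a i\<close>, the linear forms that kill it are
  freely generated by the forms \<open>e i - a i * e d\<close> for \<open>i < d\<close>, where \<open>e i\<close> takes the \<open>i\<close>th
  coefficient. Their values at \<open>f\<close> are \<open>d\<close> generators of the ideal, and \<open>d\<close> is the codimension of a
  surface in the \<open>(d + 2)\<close>-dimensional chart.\<close>

definition chart_generator :: "nat \<Rightarrow> 4 cpoly \<Rightarrow> complex^4^4 \<Rightarrow> nat \<Rightarrow> nat cpoly" where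
  "chart_generator d f A i =
     coeff (chart_f A f) i - coeff (chart_ggh d) i * coeff (chart_f A f) d"

lemma chart_generator_mem:
  assumes "d \<ge> 4" "i < d"
  shows "chart_generator d f A i \<in> chart_ideal d f A"
proof -
  define \<phi> where "\<phi> = (\<lambda>j. if j = i then 1 else if j = d then - coeff (chart_ggh d) i else 0)"
  have sum: "(\<Sum>j\<le>d. \<phi> j * c j) = c i - coeff (chart_ggh d) i * c d" for c
  proof -
    have "(\<Sum>j\<le>d. \<phi> j * c j) = (\<Sum>j\<in>{i, d}. \<phi> j * c j)"
      using assms by (intro sum.mono_neutral_right) (auto simp: \<phi>_def)
    then show ?thesis using assms by (simp add: \<phi>_def)
  qed
  have "\<forall>j\<le>d. \<phi> j \<in> cpoly_ring (d + 2)"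
    using assms coeff_chart_ggh_mem[of d i]
    by (auto simp: \<phi>_def cpoly_ring_simps simp del: add_2_eq_Suc')
  moreover have "(\<Sum>j\<le>d. \<phi> j * coeff (chart_ggh d) j) = 0"
    using assms by (simp add: sum coeff_chart_ggh_top)
  ultimately show ?thesis
    unfolding chart_ideal_def chart_generator_def by (auto simp flip: sum)
qed

lemma chart_ideal_generated:
  assumes "d \<ge> 4" "p \<in> chart_ideal d f A"
  obtains \<phi> where "\<forall>i<d. \<phi> i \<in> cpoly_ring (d + 2)"
    "p = (\<Sum>i<d. \<phi> i * chart_generator d f A i)"
proof -
  obtain \<phi> where \<phi>: "\<And>i. i \<le> d \<Longrightarrow> \<phi> i \<in> cpoly_ring (d + 2)"
    "(\<Sum>i\<le>d. \<phi> i * coeff (chart_ggh d) i) = 0" "p = (\<Sum>i\<le>d. \<phi> i * coeff (chart_f A f) i)"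
    using assms(2) unfolding chart_ideal_def by auto
  have split: "(\<Sum>i\<le>d. c i) = (\<Sum>i<d. c i) + c d" for c :: "nat \<Rightarrow> nat cpoly"
    by (simp add: lessThan_Suc_atMost[symmetric])
  have "\<phi> d = - (\<Sum>i<d. \<phi> i * coeff (chart_ggh d) i)"
    using \<phi>(2) unfolding split by (simp add: coeff_chart_ggh_top[OF assms(1)] eq_neg_iff_add_eq_0 add.commute)
  then have "p = (\<Sum>i<d. \<phi> i * chart_generator d f A i)"
    unfolding \<phi>(3) split
    by (simp add: chart_generator_def algebra_simps sum_subtractf sum_distrib_left sum_distrib_right)
  with \<phi>(1) show ?thesis by (intro that[of \<phi>]) auto
qed

lemma degree_chart_f:
  assumes "form d f"
  shows "degree (chart_f A f) \<le> d"
proof -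
  have "degree ([:cnst (Poly_Mapping.lookup f m):] *
      (\<Prod>i\<in>Poly_Mapping.keys m. [:chart_w A i, chart_u A i:] ^ Poly_Mapping.lookup m i)) \<le> d"
    (is "degree (_ * ?P) \<le> d") if "m \<in> Poly_Mapping.keys f" for m
  proof -
    have "degree ([:chart_w A i, chart_u A i:] ^ n) \<le> n" for i n
      using degree_power_le[of "[:chart_w A i, chart_u A i:]" n]
      by (rule order_trans) (auto intro: order_trans[OF mult_le_mono1[of _ 1]])
    then have "degree ?P \<le> (\<Sum>i\<in>Poly_Mapping.keys m. Poly_Mapping.lookup m i)"
      by (intro order_trans[OF degree_prod_sum_le]) (auto intro: sum_mono)
    also have "\<dots> = (\<Sum>i\<in>UNIV. Poly_Mapping.lookup m i)"
      by (intro sum.mono_neutral_left) (auto simp: in_keys_iff)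
    also have "\<dots> = d" using assms that by (simp add: form_def)
    finally show ?thesis
      using degree_mult_le[of "[:cnst (Poly_Mapping.lookup f m):]" ?P] by simp
  qed
  then show ?thesis
    unfolding chart_f_def subst_def by (intro degree_sum_le) auto
qed

lemma val_poly_chart_g: "val_poly y chart_g = [:y 5, y 4, 1:]"
  by (simp add: val_poly_def chart_g_def map_poly_pCons ring_morphism_simps[OF val_morphism] ring_morphism_id)

lemma diff_poly_chart_g: "diff_poly y v chart_g = [:v 5, v 4:]"
  by (simp add: diff_poly_def chart_g_def map_poly_pCons differential_simps)

lemma coeff_val_poly_chart_h:
  "coeff (val_poly y (chart_h d)) i = (if i < d - 4 then y (6 + i) else if i = d - 4 then 1 else 0)"
  by (simp add: coeff_chart_h ring_morphism_simps[OF val_morphism] ring_morphism_id)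

lemma coeff_diff_poly_chart_h:
  "coeff (diff_poly y v (chart_h d)) i = (if i < d - 4 then v (6 + i) else 0)"
  by (simp add: coeff_chart_h differential_simps)

section \<open>Tangent vectors and smoothness at a point of a chart\<close>

text \<open>A point of a chart whose line is spanned by the first two columns of \<open>A\<close> (the choice of \<open>A\<close> can achieve
  this for any line) and at which \<open>f\<close> restricts to \<open>C G\<^sup>2 H\<close>, with \<open>C \<noteq> 0\<close> and \<open>G\<close>, \<open>H\<close> without
  common root. The last two conditions are the hypotheses of the theorem that the line is not
  contained in the surface and that no \<open>q\<^sub>j\<close> is one of the \<open>p\<^sub>i\<close>.\<close>

locale bitangent_chart =
  fixes d :: nat and f :: "4 cpoly" and A :: "complex^4^4" and y :: "nat \<Rightarrow> complex"
    and C :: complex and G H :: "complex poly"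
  assumes d: "d \<ge> 5" and form: "form d f" and C: "C \<noteq> 0"
    and y: "y \<in> cspace (d + 2)" "\<And>i. i < 4 \<Longrightarrow> y i = 0"
    and G: "G = val_poly y chart_g" and H: "H = val_poly y (chart_h d)"
    and f_on_line: "\<And>s. val (\<lambda>k. A $ k $ 1 + s * A $ k $ 0) f = C * ((poly G s)\<^sup>2 * poly H s)"
    and no_common_root: "\<And>s. \<not> (poly G s = 0 \<and> poly H s = 0)"
begin

lemma d4: "d \<ge> 4" using d by simp

lemma degree_G: "degree G = 2" by (simp add: G val_poly_chart_g)

lemma degree_H: "degree H = d - 4"
  by (rule antisym)
    (auto intro!: degree_le le_degree simp: coeff_val_poly_chart_h H simp del: coeff_val_poly)

lemma nonzero: "G \<noteq> 0" "H \<noteq> 0"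
  using degree_G degree_H d by auto

lemma jet_chart:
  "jet y v (chart_u A k) = [:A $ k $ 0, v 0 * A $ k $ 2 + v 1 * A $ k $ 3:]"
  "jet y v (chart_w A k) = [:A $ k $ 1, v 2 * A $ k $ 2 + v 3 * A $ k $ 3:]"
  using y(2) by (simp_all add: chart_u_def chart_w_def ring_morphism_simps[OF jet_morphism]
    ring_morphism_const_poly mult.commute)

lemma val_chart: "val y (chart_u A k) = A $ k $ 0" "val y (chart_w A k) = A $ k $ 1"
  using y(2) by (simp_all add: chart_u_def chart_w_def ring_morphism_simps[OF val_morphism]
    ring_morphism_id)

lemma val_poly_chart_f: "val_poly y (chart_f A f) = smult C (G\<^sup>2 * H)"
proof -
  have "poly (val_poly y (chart_f A f)) s = poly (smult C (G\<^sup>2 * H)) s" for s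
    unfolding chart_f_def
    by (subst poly_val_diff_poly_subst(1)[OF jet_chart]) (simp add: f_on_line)
  then show ?thesis by (rule poly_eqI_values)
qed

text \<open>The line coordinates \<open>v 0, ..., v 3\<close> move the point \<open>s u + w\<close> in the direction
  \<open>(v 2 + s v 0) e2 + (v 3 + s v 1) e3\<close>; the coordinates of the two divisors do not move it.\<close>

lemma poly_diff_poly_chart_f:
  "poly (diff_poly y v (chart_f A f)) s =
     (v 2 + s * v 0) * differential f (\<lambda>k. A $ k $ 1 + s * A $ k $ 0) (\<lambda>k. A $ k $ 2) +
     (v 3 + s * v 1) * differential f (\<lambda>k. A $ k $ 1 + s * A $ k $ 0) (\<lambda>k. A $ k $ 3)"
  unfolding differential_linear[symmetric] chart_f_def
  by (subst poly_val_diff_poly_subst(2)[OF jet_chart]) (simp add: algebra_simps)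

lemma diff_poly_chart_f_cong:
  "(\<And>i. i < 4 \<Longrightarrow> v i = v' i) \<Longrightarrow> diff_poly y v (chart_f A f) = diff_poly y v' (chart_f A f)"
  by (rule poly_eqI_values) (simp add: poly_diff_poly_chart_f)

lemma val_poly_ggh: "val_poly y (chart_ggh d) = G\<^sup>2 * H"
  by (simp add: ring_morphism_simps[OF val_poly_morphism] G H)

lemma degree_ggh: "degree (G\<^sup>2 * H) = d" "coeff (G\<^sup>2 * H) d = 1"
proof -
  show "degree (G\<^sup>2 * H) = d"
    using nonzero d by (simp add: degree_mult_eq degree_power_eq degree_G degree_H)
  have "coeff (val_poly y (chart_ggh d)) d = 1"
    using d by (simp add: coeff_chart_ggh_top ring_morphism_simps[OF val_morphism] ring_morphism_id)
  then show "coeff (G\<^sup>2 * H) d = 1" by (simp add: val_poly_ggh)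
qed

lemma diff_poly_ggh:
  "diff_poly y v (chart_ggh d) =
    G * (2 * diff_poly y v chart_g * H + diff_poly y v (chart_h d) * G)"
  by (simp add: diff_poly_mult power2_eq_square ring_morphism_simps[OF val_poly_morphism] algebra_simps
      flip: G H)

text \<open>The differentials of the \<open>d\<close> generators form one polynomial: the derivative of \<open>f\<close>, minus \<open>C\<close>
  times the derivative of \<open>g\<^sup>2 h\<close>, reduced modulo \<open>G\<^sup>2 H\<close> to degree less than \<open>d\<close>.\<close>

lemma differential_generator:
  "differential (chart_generator d f A i) y v =
    coeff (diff_poly y v (chart_f A f) - smult (coeff (diff_poly y v (chart_f A f)) d) (G\<^sup>2 * H) -
      smult C (diff_poly y v (chart_ggh d))) i"
proof -
  have "val y (coeff (chart_ggh d) j) = coeff (G\<^sup>2 * H) j" for j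
    by (metis coeff_val_poly val_poly_ggh)
  moreover have "val y (coeff (chart_f A f) d) = C"
    using degree_ggh(2) by (metis coeff_val_poly val_poly_chart_f coeff_smult mult.right_neutral)
  ultimately show ?thesis
    by (simp add: chart_generator_def differential_simps differential_mult algebra_simps)
qed

lemma val_generator: "val y (chart_generator d f A i) = 0"
proof -
  have "val y (coeff (chart_ggh d) j) = coeff (G\<^sup>2 * H) j" for j
    by (metis coeff_val_poly val_poly_ggh)
  moreover have "val y (coeff (chart_f A f) j) = C * coeff (G\<^sup>2 * H) j" for j
    by (metis coeff_val_poly val_poly_chart_f coeff_smult)
  ultimately show ?thesis
    by (simp add: chart_generator_def ring_morphism_simps[OF val_morphism] ring_morphism_id degree_ggh)
qed

lemma degree_diff_poly_chart_h: "degree (diff_poly y v (chart_h d)) < d - 4"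
  using d by (intro degree_lessI) (auto simp: coeff_chart_h differential_simps)

text \<open>If two tangent vectors move the line in the same way, their differences \<open>\<gamma>\<close> and \<open>\<eta>\<close> in the
  coordinates of \<open>g\<close> and \<open>h\<close> satisfy \<open>G (2 \<gamma> H + \<eta> G) = 0\<close>. As \<open>g\<close> and \<open>h\<close> are monic, \<open>\<gamma>\<close> and \<open>\<eta>\<close> have
  smaller degrees than \<open>G\<close> and \<open>H\<close>, so both vanish by coprimality.\<close>

lemma tangent_determined_by_line:
  assumes "v \<in> zariski_tangent (d + 2) (chart_ideal d f A) y"
    and "v' \<in> zariski_tangent (d + 2) (chart_ideal d f A) y"
    and eq: "\<And>j. j < 4 \<Longrightarrow> v j = v' j"
  shows "v = v'"
proof -
  let ?\<gamma> = "\<lambda>v. diff_poly y v chart_g" and ?\<eta> = "\<lambda>v. diff_poly y v (chart_h d)"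
  let ?K = "\<lambda>v. 2 * ?\<gamma> v * H + ?\<eta> v * G"
  have zero: "differential (chart_generator d f A i) y v = 0"
    "differential (chart_generator d f A i) y v' = 0" if "i < d" for i
    using assms(1,2) chart_generator_mem[of d i f A] that d by (auto simp: zariski_tangent_def)
  have K: "degree (G * (?K v - ?K v')) < d"
  proof -
    have "degree (G * ?K u) < d" for u
    proof -
      have "degree (?\<gamma> u) \<le> 1" by (simp add: diff_poly_chart_g)
      then have "degree (2 * ?\<gamma> u * H) \<le> d - 3"
        using degree_mult_le[of "2 * ?\<gamma> u" H] degree_mult_le[of 2 "?\<gamma> u"] d by (simp add: degree_H)
      moreover have "degree (?\<eta> u * G) \<le> d - 3"
        using degree_mult_le[of "?\<eta> u" G] degree_diff_poly_chart_h[of u] d by (simp add: degree_G)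
      ultimately have "degree (?K u) \<le> d - 3" by (rule degree_add_le)
      then show ?thesis using degree_mult_le[of G "?K u"] d by (simp add: degree_G)
    qed
    then show ?thesis by (simp add: right_diff_distrib degree_diff_less)
  qed
  have zero_coeff: "coeff (G * (?K v - ?K v')) i = 0" for i
  proof (cases "i < d")
    case True
    from zero[OF True] show ?thesis
      using C by (simp add: differential_generator diff_poly_ggh diff_poly_chart_f_cong[of v v'] eq
          right_diff_distrib)
  next
    case False
    then show ?thesis using K by (intro coeff_eq_0) simp
  qed
  then have "G * (?K v - ?K v') = 0" by (intro poly_eqI) (simp only: zero_coeff coeff_0)
  then have "?K v - ?K v' = 0" using nonzero(1) by (simp only: mult_eq_0_iff simp_thms)
  moreover have "?K v - ?K v' = (2 * (?\<gamma> v - ?\<gamma> v')) * H + (?\<eta> v - ?\<eta> v') * G"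
    by (simp add: algebra_simps)
  ultimately have "(2 * (?\<gamma> v - ?\<gamma> v')) * H + (?\<eta> v - ?\<eta> v') * G = 0" by simp
  moreover have "degree (2 * (?\<gamma> v - ?\<gamma> v')) < degree G"
    by (rule le_less_trans[OF degree_mult_le]) (simp add: diff_poly_chart_g degree_G)
  ultimately have zero: "2 * (?\<gamma> v - ?\<gamma> v') = 0 \<and> ?\<eta> v - ?\<eta> v' = 0"
    by (intro coprime_degree_unique[OF _ nonzero(2) no_common_root])
  then have h: "?\<eta> v - ?\<eta> v' = 0" by (rule conjunct2)
  from zero have "?\<gamma> v - ?\<gamma> v' = 0" by (simp only: mult_eq_0_iff) simp
  then have g: "v 5 = v' 5" "v 4 = v' 4"
    by (auto simp: diff_poly_chart_g)
  have inside: "v i = v' i" if "i < d + 2" for i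
  proof (cases "i < 6")
    case True
    then have "i < 4 \<or> i = 4 \<or> i = 5" by linarith
    then show ?thesis using eq g by blast
  next
    case False
    then have "i - 6 < d - 4" using that d by simp
    then show ?thesis
      using arg_cong[OF h, of "\<lambda>p. coeff p (i - 6)"] False
      by (simp add: coeff_chart_h differential_simps)
  qed
  have outside: "v i = v' i" if "\<not> i < d + 2" for i
    using assms(1,2) that by (auto simp: zariski_tangent_def cspace_def)
  show "v = v'"
  proof (rule ext)
    fix i
    show "v i = v' i" by (cases "i < d + 2") (rule inside outside, assumption)+
  qed
qed

text \<open>The motions of the two divisors produce \<open>G\<close> times every polynomial of degree less than \<open>d - 2\<close>. It
  remains to reach every residue modulo \<open>G\<close> by moving the line, which is possible because the two
  derivatives of \<open>f\<close> transverse to the line have no common zero on the divisor \<open>G = 0\<close>.\<close>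

lemma differential_surjective:
  assumes smooth: "\<And>s. poly G s = 0 \<Longrightarrow>
      differential f (\<lambda>k. A $ k $ 1 + s * A $ k $ 0) (\<lambda>k. A $ k $ 2) \<noteq> 0 \<or>
      differential f (\<lambda>k. A $ k $ 1 + s * A $ k $ 0) (\<lambda>k. A $ k $ 3) \<noteq> 0"
    and T: "degree T < d"
  obtains v where "v \<in> cspace (d + 2)"
    "\<And>i. i < d \<Longrightarrow> differential (chart_generator d f A i) y v = coeff T i"
proof -
  \<comment> \<open>The derivatives of \<open>f\<close> in the directions \<open>e2\<close> and \<open>e3\<close>, as polynomials in \<open>s\<close>.\<close>
  define a where "a = diff_poly y (\<lambda>i. if i = 2 then 1 else 0) (chart_f A f)"
  define b where "b = diff_poly y (\<lambda>i. if i = 3 then 1 else 0) (chart_f A f)"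
  have "\<not> (poly a s = 0 \<and> poly b s = 0 \<and> poly G s = 0)" for s
    using smooth[of s] by (auto simp: a_def b_def poly_diff_poly_chart_f)
  then obtain x z where xz: "degree x < 2" "degree z < 2" "G dvd T - (x * a + z * b)"
    using linear_combination_mod[of G a b T] by (auto simp: degree_G)
  let ?DF = "x * a + z * b"
  let ?\<kappa> = "coeff ?DF d"
  have DF: "diff_poly y v (chart_f A f) = ?DF"
    if v: "v 0 = coeff x 1" "v 1 = coeff z 1" "v 2 = coeff x 0" "v 3 = coeff z 0" for v
  proof -
    have lin: "poly p s = coeff p 0 + s * coeff p 1" if "degree p < 2" for p :: "complex poly" and s
    proof -
      have "poly p s = (\<Sum>i\<le>1. coeff p i * s ^ i)"
        unfolding poly_altdef using that
        by (intro sum.mono_neutral_left) (auto simp: coeff_eq_0)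
      then show ?thesis by simp
    qed
    show ?thesis
      by (rule poly_eqI_values)
        (simp add: poly_diff_poly_chart_f a_def b_def lin[OF xz(1)] lin[OF xz(2)] v
          algebra_simps del: One_nat_def)
  qed
  have "degree ?DF \<le> d"
  proof -
    have "?DF = diff_poly y (\<lambda>i. if i = 0 then coeff x 1 else if i = 1 then coeff z 1
        else if i = 2 then coeff x 0 else coeff z 0) (chart_f A f)" by (rule DF[symmetric]) auto
    moreover have "degree (diff_poly y v (chart_f A f)) \<le> d" for v
      using degree_chart_f[OF form, of A]
      by (intro degree_le allI impI) (simp add: coeff_eq_0 differential_simps)
    ultimately show ?thesis by simp
  qed
  \<comment> \<open>What is left of \<open>T\<close> after moving the line, reduced to degree less than \<open>d\<close>. It is divisible
    by \<open>G\<close>, and the quotient \<open>R\<close> is split between the motions of the two divisors.\<close>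
  define N where "N = T - ?DF + smult ?\<kappa> (G\<^sup>2 * H)"
  have "G dvd N"
    unfolding N_def using xz(3) by (intro dvd_add dvd_smult) (auto simp: power2_eq_square)
  then obtain R where R: "N = G * R" by blast
  have "degree N < d"
  proof -
    have "coeff N i = 0" if "i \<ge> d" for i
    proof (cases "i = d")
      case True
      then show ?thesis using T degree_ggh(2) by (simp add: N_def coeff_eq_0)
    next
      case False
      then have "coeff T i = 0" "coeff ?DF i = 0" "coeff (G\<^sup>2 * H) i = 0"
        using T that \<open>degree ?DF \<le> d\<close> degree_ggh(1) by (auto intro!: coeff_eq_0 simp del: coeff_add)
      then show ?thesis by (simp add: N_def)
    qed
    then show ?thesis using d by (intro degree_lessI) auto
  qed
  then have "degree (G * R) < d" by (simp only: R)
  then have degR: "degree R < degree G + degree H"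
    using nonzero d by (cases "R = 0") (simp_all add: degree_mult_eq degree_G degree_H)
  have "degree G > 0" "degree H > 0" using d by (simp_all add: degree_G degree_H)
  then obtain \<gamma> \<eta> where split0: "degree \<gamma> < degree G" "degree \<eta> < degree H" and
    R_split: "R = \<gamma> * H + \<eta> * G"
    by (rule coprime_degree_split[OF _ _ degR no_common_root])
  note split = split0[unfolded degree_G degree_H] R_split
  define v where "v = (\<lambda>i. if i = 0 then coeff x 1 else if i = 1 then coeff z 1
    else if i = 2 then coeff x 0 else if i = 3 then coeff z 0
    else if i = 4 then - coeff \<gamma> 1 / (2 * C) else if i = 5 then - coeff \<gamma> 0 / (2 * C)
    else if i < d + 2 then - coeff \<eta> (i - 6) / C else 0)"
  have g: "diff_poly y v chart_g = smult (- 1 / (2 * C)) \<gamma>"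
  proof (rule poly_eqI)
    fix i
    consider "i = 0" | "i = 1" | j where "i = Suc (Suc j)" by (metis One_nat_def not0_implies_Suc)
    then show "coeff (diff_poly y v chart_g) i = coeff (smult (- 1 / (2 * C)) \<gamma>) i"
      using split(1) by cases (auto simp: diff_poly_chart_g v_def coeff_eq_0 simp del: coeff_diff_poly)
  qed
  have h: "diff_poly y v (chart_h d) = smult (- 1 / C) \<eta>"
    using split(2) d by (intro poly_eqI) (auto simp: coeff_diff_poly_chart_h v_def coeff_eq_0 simp del: coeff_diff_poly)
  show ?thesis
  proof (rule that)
    show "v \<in> cspace (d + 2)" using d by (auto simp: cspace_def v_def)
    have two: "2 * smult c p = smult (2 * c) p" for c and p :: "complex poly"
      by (simp only: mult_2 smult_add_left)
    have "smult C (diff_poly y v (chart_ggh d)) =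
        smult C (G * (2 * smult (- 1 / (2 * C)) \<gamma> * H + smult (- 1 / C) \<eta> * G))"
      by (simp only: diff_poly_ggh g h)
    also have "2 * smult (- 1 / (2 * C)) \<gamma> = smult (- 1 / C) \<gamma>"
      unfolding two using C by simp
    also have "smult C (G * (smult (- 1 / C) \<gamma> * H + smult (- 1 / C) \<eta> * G)) =
        smult (C * (- 1 / C)) (G * R)"
      by (simp only: split(3) distrib_left smult_add_right mult_smult_left mult_smult_right smult_smult)
    also have "\<dots> = - N" using C by (simp add: R)
    finally have "smult C (diff_poly y v (chart_ggh d)) = - N" .
    moreover have "diff_poly y v (chart_f A f) = ?DF" by (rule DF) (auto simp: v_def)
    ultimately show "differential (chart_generator d f A i) y v = coeff T i" for i
      by (simp only: differential_generator) (simp add: N_def)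
  qed
qed

text \<open>The generators \<open>chart_generator d f A i\<close> serve as the local equations, with \<open>q = 1\<close>. Their
  differentials are independent because on the tangent vectors of the chart they take every
  vector of values.\<close>

lemma smooth_at_chart:
  assumes smooth: "\<And>s. poly G s = 0 \<Longrightarrow>
      differential f (\<lambda>k. A $ k $ 1 + s * A $ k $ 0) (\<lambda>k. A $ k $ 2) \<noteq> 0 \<or>
      differential f (\<lambda>k. A $ k $ 1 + s * A $ k $ 0) (\<lambda>k. A $ k $ 3) \<noteq> 0"
  shows "smooth_at (d + 2) (chart_ideal d f A) 2 y"
proof -
  have vanish: "val y p = 0" if p: "p \<in> chart_ideal d f A" for p
  proof -
    obtain \<phi> where "p = (\<Sum>i<d. \<phi> i * chart_generator d f A i)"
      by (rule chart_ideal_generated[OF d4 p])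
    then show ?thesis by (simp add: ring_morphism_simps[OF val_morphism] val_generator)
  qed
  have indep: "c j = 0" if c: "\<forall>v\<in>cspace (d + 2).
      (\<Sum>i<d. c i * differential (chart_generator d f A i) y v) = 0" and "j < d" for c j
  proof -
    have "degree (monom 1 j :: complex poly) < d" using \<open>j < d\<close> by (simp add: degree_monom_eq)
    then obtain v where v: "v \<in> cspace (d + 2)"
      "\<And>i. i < d \<Longrightarrow> differential (chart_generator d f A i) y v = coeff (monom 1 j) i"
      by (rule differential_surjective[OF smooth, rotated]) simp_all
    have "0 = (\<Sum>i<d. c i * differential (chart_generator d f A i) y v)"
      using bspec[OF c v(1)] by simp
    also have "\<dots> = (\<Sum>i<d. c i * coeff (monom 1 j) i)"
      by (rule sum.cong) (simp_all add: v(2))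
    also have "\<dots> = (\<Sum>i<d. if i = j then c i else 0)"
      by (rule sum.cong) auto
    also have "\<dots> = c j" using \<open>j < d\<close> by simp
    finally show ?thesis by (rule sym)
  qed
  have gen: "\<exists>\<phi>. (\<forall>i<d. \<phi> i \<in> cpoly_ring (d + 2)) \<and>
      1 * p = (\<Sum>i<d. \<phi> i * chart_generator d f A i)" if p: "p \<in> chart_ideal d f A" for p
  proof -
    obtain \<phi> where "\<forall>i<d. \<phi> i \<in> cpoly_ring (d + 2)" "p = (\<Sum>i<d. \<phi> i * chart_generator d f A i)"
      by (rule chart_ideal_generated[OF d4 p])
    then show ?thesis by (intro exI[of _ \<phi>]) simp
  qed
  show ?thesis
    unfolding smooth_at_def
  proof (intro conjI)
    show "y \<in> cspace (d + 2)" by (rule y(1))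
    show "\<forall>p\<in>chart_ideal d f A. val y p = 0" by (intro ballI vanish)
    show "\<exists>r q g. r + 2 = d + 2 \<and> q \<in> cpoly_ring (d + 2) \<and> val y q \<noteq> 0 \<and>
        (\<forall>i<r. g i \<in> chart_ideal d f A) \<and>
        (\<forall>p\<in>chart_ideal d f A. \<exists>a. (\<forall>i<r. a i \<in> cpoly_ring (d + 2)) \<and> q * p = (\<Sum>i<r. a i * g i)) \<and>
        (\<forall>c. (\<forall>v\<in>cspace (d + 2). (\<Sum>i<r. c i * differential (g i) y v) = 0) \<longrightarrow> (\<forall>i<r. c i = 0))"
    proof (rule exI[of _ d], rule exI[of _ 1], rule exI[of _ "chart_generator d f A"], intro conjI)
      show "(1 :: nat cpoly) \<in> cpoly_ring (d + 2)" by (rule cpoly_ring_simps)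
      show "val y 1 \<noteq> 0" by (simp add: ring_morphism_simps[OF val_morphism])
      show "\<forall>i<d. chart_generator d f A i \<in> chart_ideal d f A"
        by (simp add: chart_generator_mem d4)
      show "\<forall>p\<in>chart_ideal d f A. \<exists>a. (\<forall>i<d. a i \<in> cpoly_ring (d + 2)) \<and>
          1 * p = (\<Sum>i<d. a i * chart_generator d f A i)"
        by (intro ballI gen)
      show "\<forall>c. (\<forall>v\<in>cspace (d + 2). (\<Sum>i<d. c i * differential (chart_generator d f A i) y v) = 0) \<longrightarrow>
          (\<forall>i<d. c i = 0)"
      proof (intro allI impI)
        fix c j
        assume "\<forall>v\<in>cspace (d + 2). (\<Sum>i<d. c i * differential (chart_generator d f A i) y v) = 0"
          and "j < d"
        then show "c j = 0" by (rule indep)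
      qed
    qed simp
  qed
qed

end

section \<open>Bitangents lie in charts\<close>

definition columns_matrix :: "complex^4 \<Rightarrow> complex^4 \<Rightarrow> complex^4 \<Rightarrow> complex^4 \<Rightarrow> complex^4^4" where
  "columns_matrix u w a b =
    (\<chi> k j. if j = 0 then u $ k else if j = 1 then w $ k else if j = 2 then a $ k else b $ k)"

lemma columns_matrix_nth:
  "columns_matrix u w a b $ k $ 0 = u $ k" "columns_matrix u w a b $ k $ 1 = w $ k"
  "columns_matrix u w a b $ k $ 2 = a $ k" "columns_matrix u w a b $ k $ 3 = b $ k"
  by (simp_all add: columns_matrix_def)

lemma invertible_columns_matrix:
  assumes "vec.span {u, w, a, b} = UNIV"
  shows "invertible (columns_matrix u w a b)"
proof -
  let ?A = "columns_matrix u w a b"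
  have "u = column 0 ?A" "w = column 1 ?A" "a = column 2 ?A" "b = column 3 ?A"
    by (simp_all add: column_def columns_matrix_nth vec_eq_iff)
  then have "{u, w, a, b} \<subseteq> columns ?A" unfolding columns_def by blast
  then have "vec.span (columns ?A) = UNIV"
    using assms vec.span_mono by blast
  then obtain B where B: "?A ** B = mat 1"
    using matrix_right_invertible_span_columns by blast
  then show ?thesis
    using matrix_left_right_inverse invertible_def by blast
qed

lemma cuts_out_scale:
  assumes "cuts_out l D g" "k \<noteq> 0"
  shows "cuts_out l D (\<lambda>v. k * g v)"
proof -
  obtain c lam where c: "c \<noteq> 0" and lin: "\<forall>p\<in>#D. Vector_Spaces.linear (*s) (*) (lam p)"
    and zero: "\<forall>p\<in>#D. {v\<in>l. lam p v = 0} = p" and g: "\<forall>v\<in>l. g v = c * (\<Prod>p\<in>#D. lam p v)"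
    by (rule cuts_outE[OF assms(1)])
  show ?thesis
    unfolding cuts_out_def
  proof (rule exI[of _ "k * c"], rule exI[of _ lam], intro conjI ballI)
    show "k * c \<noteq> 0" using c assms(2) by simp
    show "Vector_Spaces.linear (*s) (*) (lam p)" if "p \<in># D" for p by (rule bspec[OF lin that])
    show "{v\<in>l. lam p v = 0} = p" if "p \<in># D" for p by (rule bspec[OF zero that])
    show "k * g v = k * c * (\<Prod>p\<in>#D. lam p v)" if "v \<in> l" for v
      using bspec[OF g that] by simp
  qed
qed

lemma binary_form_dehomogenize:
  assumes "degree p \<le> m"
  shows "binary_form m p s 1 = poly p s"
proof -
  have "poly p s = (\<Sum>i\<le>m. coeff p i * s ^ i)"
    unfolding poly_altdef using assms
    by (intro sum.mono_neutral_left) (auto simp: coeff_eq_0)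
  then show ?thesis by (simp add: binary_form_def)
qed

text \<open>The inverse of the chart on the flags over its central line: the coordinates are read off from
  the monic polynomials defining the two divisors.\<close>

definition chart_point :: "nat \<Rightarrow> complex poly \<Rightarrow> complex poly \<Rightarrow> nat \<Rightarrow> complex" where
  "chart_point d G H i = (if i < 4 then 0 else if i = 4 then coeff G 1 else if i = 5 then coeff G 0
     else if i < d + 2 then coeff H (i - 6) else 0)"

lemma val_poly_chart_point:
  assumes "degree G = 2" "lead_coeff G = 1" and "degree H = d - 4" "lead_coeff H = 1" and "d \<ge> 4"
  shows "val_poly (chart_point d G H) chart_g = G" "val_poly (chart_point d G H) (chart_h d) = H"
proof -
  show "val_poly (chart_point d G H) chart_g = G"
  proof (rule poly_eqI)
    fix i :: nat
    have "i = 0 \<or> i = 1 \<or> i = 2 \<or> 2 < i" by linarith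
    then show "coeff (val_poly (chart_point d G H) chart_g) i = coeff G i"
      using assms(1,2)
      by (elim disjE) (simp_all add: val_poly_chart_g chart_point_def coeff_eq_0 coeff_pCons
          numeral_2_eq_2 split: nat.split del: coeff_val_poly)
  qed
  show "val_poly (chart_point d G H) (chart_h d) = H"
    using assms(3-5)
    by (intro poly_eqI) (auto simp: coeff_val_poly_chart_h chart_point_def coeff_eq_0 simp del: coeff_val_poly)
qed

text \<open>The last conclusion is where smoothness of the surface enters. At a zero \<open>s\<close> of \<open>G\<close> the derivatives
  of \<open>f\<close> along the line vanish by tangency; if both transverse derivatives vanished as well, the
  whole differential would, and the surface would be singular at that point.\<close>

lemma bitangent_chart_exists:
  assumes "d \<ge> 5" and "form d f"
    and bit: "(l, D, E) \<in> bitangents d f" and notin: "\<not> in_hypersurface l f"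
    and disjoint: "set_mset D \<inter> set_mset E = {}"
  obtains A y C G H where "chart_at d A y (l, D, E)" "bitangent_chart d f A y C G H"
    "(\<forall>p\<in>#D. hypersurface_smooth_at f p) \<longrightarrow> (\<forall>s. poly G s = 0 \<longrightarrow>
      differential f (\<lambda>k. A $ k $ 1 + s * A $ k $ 0) (\<lambda>k. A $ k $ 2) \<noteq> 0 \<or>
      differential f (\<lambda>k. A $ k $ 1 + s * A $ k $ 0) (\<lambda>k. A $ k $ 3) \<noteq> 0)"
proof -
  from bit have flag: "(l, D, E) \<in> flags d" and
    "\<exists>g h c. cuts_out l D g \<and> cuts_out l E h \<and> (\<forall>v\<in>l. fval f v = c * ((g v)\<^sup>2 * h v))"
    by (simp_all add: bitangents_def)
  then obtain g h c where g: "cuts_out l D g" and h: "cuts_out l E h"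
    and f0: "\<forall>v\<in>l. fval f v = c * ((g v)\<^sup>2 * h v)"
    by (elim exE conjE)
  note f = bspec[OF f0]
  have l: "line l" "vec.subspace l" and D: "size D = 2" "\<And>p. p \<in># D \<Longrightarrow> pnt p"
    and E: "size E = d - 4" "\<And>p. p \<in># E \<Longrightarrow> pnt p"
    using flag by (auto simp: flags_def line_def eff_divisors_def)
  obtain u w where span_l: "l = vec.span {u, w}" and ind: "vec.independent {u, w}" "u \<noteq> w"
    and avoid: "\<forall>p\<in>set_mset D \<union> set_mset E. u \<notin> p"
    by (rule line_basis_avoiding[OF l(1), of "set_mset D \<union> set_mset E"]) (use D(2) E(2) in auto)
  have ul: "u \<in> l" and wl: "w \<in> l" by (simp_all add: span_l vec.span_base)
  obtain a b where span: "vec.span {u, w, a, b} = UNIV" by (rule extend_to_basis[OF ind])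
  have nz: "s *s u + w \<noteq> 0" for s
  proof
    assume "s *s u + w = 0"
    then have "w = (- s) *s u" by (simp add: eq_neg_iff_add_eq_0 add.commute)
    moreover have "(- s) *s u \<in> vec.span {u}" by (intro vec.span_scale vec.span_base) simp
    ultimately have "w \<in> vec.span {u}" by simp
    moreover have "vec.independent (insert w {u})" using ind(1) by (simp add: insert_commute)
    ultimately show False using ind(2) by (simp add: vec.independent_insert)
  qed
  have avoidD: "\<forall>p\<in>#D. u \<notin> p" and avoidE: "\<forall>p\<in>#E. u \<notin> p" using avoid by auto
  obtain kG G where kG: "kG \<noteq> 0" and G: "degree G = size D" "lead_coeff G = 1"
    and gG: "\<forall>s t. g (s *s u + t *s w) = kG * binary_form (size D) G s t"
    and rootG: "\<forall>s. poly G s = 0 \<longleftrightarrow> (\<exists>p\<in>#D. s *s u + w \<in> p)"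
    by (rule cuts_out_binary_form[OF g l(2) ul wl avoidD])
  obtain kH H where kH: "kH \<noteq> 0" and H: "degree H = size E" "lead_coeff H = 1"
    and hH: "\<forall>s t. h (s *s u + t *s w) = kH * binary_form (size E) H s t"
    and rootH: "\<forall>s. poly H s = 0 \<longleftrightarrow> (\<exists>p\<in>#E. s *s u + w \<in> p)"
    by (rule cuts_out_binary_form[OF h l(2) ul wl avoidE])
  define A where "A = columns_matrix u w a b"
  define y where "y = chart_point d G H"
  have A: "A $ k $ 0 = u $ k" "A $ k $ 1 = w $ k" "A $ k $ 2 = a $ k" "A $ k $ 3 = b $ k" for k
    by (simp_all add: A_def columns_matrix_nth)
  have y: "y \<in> cspace (d + 2)" "\<And>i. i < 4 \<Longrightarrow> y i = 0"
    using assms(1) by (auto simp: y_def chart_point_def cspace_def)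
  have valG: "val_poly y chart_g = G" and valH: "val_poly y (chart_h d) = H"
    unfolding y_def using val_poly_chart_point[of G H d] G H D(1) E(1) assms(1) by simp_all
  have vector: "(\<lambda>k. w $ k + s * u $ k) = ($) (s *s u + w)" for s
    by (auto simp: add.commute)
  have mem: "s *s u + w \<in> l" for s
    using l(2) ul wl by (intro vec.subspace_add vec.subspace_scale)
  have on_line: "fval f (s *s u + w) = (c * kG\<^sup>2 * kH) * ((poly G s)\<^sup>2 * poly H s)" for s
  proof -
    have "g (s *s u + w) = kG * poly G s" "h (s *s u + w) = kH * poly H s"
      using gG[THEN spec, THEN spec, of s 1] hH[THEN spec, THEN spec, of s 1] G H
      by (simp_all add: binary_form_dehomogenize)
    then show ?thesis using f[OF mem[of s]] by (simp add: power_mult_distrib mult_ac)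
  qed
  have "c \<noteq> 0" using notin f unfolding in_hypersurface_def by (metis mult_zero_left)
  have no_common_root: "\<not> (poly G s = 0 \<and> poly H s = 0)" for s
  proof
    assume "poly G s = 0 \<and> poly H s = 0"
    then obtain p q where pq: "p \<in># D" "s *s u + w \<in> p" "q \<in># E" "s *s u + w \<in> q"
      using rootG rootH by blast
    then have "p = q" by (intro pnt_eqI[OF D(2) E(2) _ _ nz])
    then show False using pq disjoint by blast
  qed
  have chart: "bitangent_chart d f A y (c * kG\<^sup>2 * kH) G H"
  proof
    show "val (\<lambda>k. A $ k $ 1 + s * A $ k $ 0) f = c * kG\<^sup>2 * kH * ((poly G s)\<^sup>2 * poly H s)" for s
      unfolding A vector by (rule on_line)
  qed (use assms(1,2) \<open>c \<noteq> 0\<close> kG kH y valG valH no_common_root in auto)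
  interpret bitangent_chart d f A y "c * kG\<^sup>2 * kH" G H by (rule chart)
  have "chart_at d A y (l, D, E)"
  proof -
    have inv: "invertible A" unfolding A_def by (rule invertible_columns_matrix[OF span])
    have u: "(\<chi> k. val y (chart_u A k)) = u" and w: "(\<chi> k. val y (chart_w A k)) = w"
      by (simp_all add: val_chart A vec_eq_iff)
    have "\<exists>g. cuts_out l D g \<and> (\<forall>s t. g (s *s u + t *s w) = binary_form 2 G s t)"
    proof (intro exI[of _ "\<lambda>v. inverse kG * g v"] conjI allI)
      show "cuts_out l D (\<lambda>v. inverse kG * g v)" using kG by (intro cuts_out_scale[OF g]) simp
      show "inverse kG * g (s *s u + t *s w) = binary_form 2 G s t" for s t
        using gG[THEN spec, THEN spec, of s t] kG D(1) by simp
    qed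
    moreover have "\<exists>h. cuts_out l E h \<and> (\<forall>s t. h (s *s u + t *s w) = binary_form (d - 4) H s t)"
    proof (intro exI[of _ "\<lambda>v. inverse kH * h v"] conjI allI)
      show "cuts_out l E (\<lambda>v. inverse kH * h v)" using kH by (intro cuts_out_scale[OF h]) simp
      show "inverse kH * h (s *s u + t *s w) = binary_form (d - 4) H s t" for s t
        using hH[THEN spec, THEN spec, of s t] kH E(1) by simp
    qed
    ultimately show ?thesis
      unfolding chart_at_def Let_def u w prod.case val_poly_def[symmetric] valG valH
      using y(1) flag span_l inv by (intro conjI)
  qed
  moreover have "differential f (\<lambda>k. A $ k $ 1 + s * A $ k $ 0) (\<lambda>k. A $ k $ 2) \<noteq> 0 \<or>
      differential f (\<lambda>k. A $ k $ 1 + s * A $ k $ 0) (\<lambda>k. A $ k $ 3) \<noteq> 0"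
    if smooth: "\<forall>p\<in>#D. hypersurface_smooth_at f p" and "poly G s = 0" for s
  proof (rule ccontr)
    let ?x = "s *s u + w"
    assume contr: "\<not> ?thesis"
    obtain p where p: "p \<in># D" "?x \<in> p" using \<open>poly G s = 0\<close> rootG by blast
    have "differential f (($) ?x) (($) v) = 0" if "v \<in> l" for v
      using differential_along_bitangent[OF g h l(2) f mem that p] .
    moreover have "differential f (($) ?x) (($) a) = 0" "differential f (($) ?x) (($) b) = 0"
      using contr by (simp_all add: A flip: vector)
    ultimately have basis: "differential f (($) ?x) (($) v) = 0" if "v \<in> {u, w, a, b}" for v
      using that ul wl by blast
    have "vec.subspace {v. differential f (($) ?x) (($) v) = 0}"
    proof (rule vec.subspaceI)
      have comb: "differential f (($) ?x) (($) (r *s v + t *s v')) =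
          r * differential f (($) ?x) (($) v) + t * differential f (($) ?x) (($) v')" for r t v v'
      proof -
        have "($) (r *s v + t *s v') = (\<lambda>i. r * v $ i + t * v' $ i)" by auto
        then show ?thesis by (simp only: differential_linear)
      qed
      show "0 \<in> {v. differential f (($) ?x) (($) v) = 0}"
        using comb[of 0 0 0 0] by simp
      show "v + v' \<in> {v. differential f (($) ?x) (($) v) = 0}"
        if "v \<in> {v. differential f (($) ?x) (($) v) = 0}" "v' \<in> {v. differential f (($) ?x) (($) v) = 0}" for v v'
        using comb[of 1 v 1 v'] that by simp
      show "r *s v \<in> {v. differential f (($) ?x) (($) v) = 0}"
        if "v \<in> {v. differential f (($) ?x) (($) v) = 0}" for r v
        using comb[of r v 0 0] that by simp
    qed
    then have "vec.span {u, w, a, b} \<subseteq> {v. differential f (($) ?x) (($) v) = 0}"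
      by (intro vec.span_minimal) (auto intro: basis)
    then have all: "differential f (($) ?x) (($) v) = 0" for v
      unfolding span by blast
    obtain z where z: "differential f (($) ?x) z \<noteq> 0"
      using bspec[OF smooth p(1)] p(2) nz[of s] unfolding hypersurface_smooth_at_def by blast
    have "($) (vec_lambda z) = z" by (rule ext) simp
    then show False using all[of "vec_lambda z"] z by simp
  qed
  ultimately show ?thesis using chart by (intro that[of A y _ G H]) auto
qed

section \<open>Immersion and smoothness of the congruence of bitangents\<close>

theorem theorem3p3:
  fixes d :: nat and f :: "4 cpoly" and l p1 p2 :: csub and E :: "csub multiset"
  assumes "d \<ge> 5"
    and "form d f" and "f \<noteq> 0"
    and "(l, {#p1, p2#}, E) \<in> bitangents d f"
    and "\<not> in_hypersurface l f"
    and "{p1, p2} \<inter> set_mset E = {}"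
  shows "immersed_at d f (l, {#p1, p2#}, E) \<and>
    (hypersurface_smooth_at f p1 \<and> hypersurface_smooth_at f p2 \<longrightarrow>
      smooth_surface_at d f (l, {#p1, p2#}, E))"
proof -
  have disjoint: "set_mset {#p1, p2#} \<inter> set_mset E = {}" using assms(6) by simp
  obtain A y C G H where at: "chart_at d A y (l, {#p1, p2#}, E)"
    and chart: "bitangent_chart d f A y C G H"
    and smooth: "(\<forall>p\<in>#{#p1, p2#}. hypersurface_smooth_at f p) \<longrightarrow> (\<forall>s. poly G s = 0 \<longrightarrow>
      differential f (\<lambda>k. A $ k $ 1 + s * A $ k $ 0) (\<lambda>k. A $ k $ 2) \<noteq> 0 \<or>
      differential f (\<lambda>k. A $ k $ 1 + s * A $ k $ 0) (\<lambda>k. A $ k $ 3) \<noteq> 0)"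
    by (rule bitangent_chart_exists[OF assms(1,2,4,5) disjoint])
  interpret bitangent_chart d f A y C G H by (rule chart)
  have "inj_on (\<lambda>v. \<lambda>j\<in>{..<4}. differential (var j) y v)
      (zariski_tangent (d + 2) (chart_ideal d f A) y)"
  proof (rule inj_onI)
    fix v v'
    assume v: "v \<in> zariski_tangent (d + 2) (chart_ideal d f A) y"
      and v': "v' \<in> zariski_tangent (d + 2) (chart_ideal d f A) y"
      and eq: "(\<lambda>j\<in>{..<4}. differential (var j) y v) = (\<lambda>j\<in>{..<4}. differential (var j) y v')"
    have "v j = v' j" if "j < 4" for j
      using fun_cong[OF eq, of j] that by (simp add: differential_simps)
    then show "v = v'" by (rule tangent_determined_by_line[OF v v'])
  qed
  then have "immersed_at d f (l, {#p1, p2#}, E)"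
    unfolding immersed_at_def using at by blast
  moreover have "smooth_surface_at d f (l, {#p1, p2#}, E)"
    if "hypersurface_smooth_at f p1 \<and> hypersurface_smooth_at f p2"
  proof -
    have "smooth_at (d + 2) (chart_ideal d f A) 2 y"
      by (rule smooth_at_chart) (use smooth that in simp)
    then show ?thesis unfolding smooth_surface_at_def using at by blast
  qed
  ultimately show ?thesis by blast
qed

end
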